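(* Let $G$ be a topological group, $X$ a compact $G$-system, $f\in C(X)$, and let $E=E(X)$ be the enveloping semigroup of $X$. The following are equivalent: (1) $f\in Asp(X)$. (2) $E^f$ is a fragmented family. (3) $E^f$ is a barely continuous family. (4) For every closed subset $Y\subset X$ (equivalently, for every closed $G$-invariant subset $Y\subset X$) there exists a dense $G_\delta$ subset $Y_0$ of $Y$ such that the induced map $p_f:Y_0\to\mathbb{R}$, $p_f(y)=f(py)$, is continuous for every $p\in E$.
   Context: A compact $G$-system is a compact Hausdorff space $X$ with a (jointly) continuous left action of the topological group $G$; $\breve g:X\to X$, $x\mapsto gx$. The enveloping semigroup $E(X)$ is the closure of $\{\breve g:g\in G\}$ in $X^X$ with the pointwise convergence (product) topology. For $f\in C(X)$ (continuous real functions), $E^f=\{p_f:X\to\mathbb R\}_{p\in E}$, where $p_f(x)=f(px)$. $f\in Asp(X)$ (Asplund function) means: for every countable subgroup $H<G$ the pseudometric space $(X,\rho_{H,f})$ is separable, where $\rho_{H,f}(x,y)=\sup_{h\in H}|f(hx)-f(hy)|$. A family $\mathcal F$ of functions $X\to\mathbb R$ is fragmented if for every nonempty $A\subset X$ and $\varepsilon>0$ there is an open $O\subset X$ with $O\cap A\ne\emptyset$ and $\operatorname{diam}\phi(O\cap A)\leq\varepsilon$ for every $\phi\in\mathcal F$ simultaneously. The family is barely continuous if every nonempty closed $A\subset X$ contains a point $a$ at which the family of restrictions $\{\phi|_A:\phi\in\mathcal F\}$ is equicontinuous. *)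

theory Defs
  imports "HOL-Analysis.Analysis" "HOL-Algebra.Group_Action"
begin

locale topological_group = group G for G (structure) +
  fixes T :: "'g topology"
  assumes topspace_eq: "topspace T = carrier G"
    and continuous_mult: "continuous_map (prod_topology T T) T (\<lambda>(g, h). g \<otimes> h)"
    and continuous_inv: "continuous_map T T (\<lambda>g. inv g)"

(* By group_action, each \<phi> g is an extensional function on topspace X (it is undefined
   outside), so \<phi> g is literally the translation x \<mapsto> gx as a point of X^X. *)
locale compact_G_system =
  topological_group G T + group_action G "topspace X" \<phi>
  for G (structure) and T and X :: "'x topology" and \<phi> +
  assumes compact: "compact_space X"
    and Hausdorff: "Hausdorff_space X"
    and continuous_action: "continuous_map (prod_topology T X) X (\<lambda>(g, x). \<phi> g x)"

definition enveloping_semigroup ::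
    "('g, 'm) monoid_scheme \<Rightarrow> 'x topology \<Rightarrow> ('g \<Rightarrow> 'x \<Rightarrow> 'x) \<Rightarrow> ('x \<Rightarrow> 'x) set" where
  "enveloping_semigroup G X \<phi> =
     product_topology (\<lambda>_. X) (topspace X) closure_of (\<phi> ` carrier G)"

definition induced_map :: "'x topology \<Rightarrow> ('x \<Rightarrow> real) \<Rightarrow> ('x \<Rightarrow> 'x) \<Rightarrow> 'x \<Rightarrow> real" where
  "induced_map X f p = (\<lambda>x\<in>topspace X. f (p x))"

definition enveloping_family ::
    "('g, 'm) monoid_scheme \<Rightarrow> 'x topology \<Rightarrow> ('g \<Rightarrow> 'x \<Rightarrow> 'x) \<Rightarrow> ('x \<Rightarrow> real) \<Rightarrow> ('x \<Rightarrow> real) set" where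
  "enveloping_family G X \<phi> f = induced_map X f ` enveloping_semigroup G X \<phi>"

definition orbit_pseudometric ::
    "('g \<Rightarrow> 'x \<Rightarrow> 'x) \<Rightarrow> 'g set \<Rightarrow> ('x \<Rightarrow> real) \<Rightarrow> 'x \<Rightarrow> 'x \<Rightarrow> real" where
  "orbit_pseudometric \<phi> H f x y = (SUP h\<in>H. \<bar>f (\<phi> h x) - f (\<phi> h y)\<bar>)"

definition pseudometric_separable :: "'x set \<Rightarrow> ('x \<Rightarrow> 'x \<Rightarrow> real) \<Rightarrow> bool" where
  "pseudometric_separable S d \<longleftrightarrow>
     (\<exists>D. countable D \<and> D \<subseteq> S \<and> (\<forall>x\<in>S. \<forall>\<epsilon>>0. \<exists>y\<in>D. d x y < \<epsilon>))"

definition Asp ::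
    "('g, 'm) monoid_scheme \<Rightarrow> 'x topology \<Rightarrow> ('g \<Rightarrow> 'x \<Rightarrow> 'x) \<Rightarrow> ('x \<Rightarrow> real) set" where
  "Asp G X \<phi> = {f. continuous_map X euclideanreal f \<and>
     (\<forall>H. subgroup H G \<and> countable H \<longrightarrow>
        pseudometric_separable (topspace X) (orbit_pseudometric \<phi> H f))}"

(* The library's real-valued diameter is only meaningful on bounded sets; an unbounded
   set has infinite diameter, hence the boundedness conjunct. *)
definition fragmented_family :: "'x topology \<Rightarrow> ('x \<Rightarrow> real) set \<Rightarrow> bool" where
  "fragmented_family X F \<longleftrightarrow>
     (\<forall>A \<epsilon>. A \<subseteq> topspace X \<and> A \<noteq> {} \<and> 0 < \<epsilon> \<longrightarrow>
        (\<exists>U. openin X U \<and> U \<inter> A \<noteq> {} \<and>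
           (\<forall>\<phi>\<in>F. bounded (\<phi> ` (U \<inter> A)) \<and> diameter (\<phi> ` (U \<inter> A)) \<le> \<epsilon>)))"

definition equicontinuous_at :: "'x topology \<Rightarrow> ('x \<Rightarrow> real) set \<Rightarrow> 'x \<Rightarrow> bool" where
  "equicontinuous_at X F a \<longleftrightarrow>
     (\<forall>\<epsilon>>0. \<exists>U. openin X U \<and> a \<in> U \<and> (\<forall>\<phi>\<in>F. \<forall>x\<in>U. \<bar>\<phi> x - \<phi> a\<bar> < \<epsilon>))"

definition barely_continuous_family :: "'x topology \<Rightarrow> ('x \<Rightarrow> real) set \<Rightarrow> bool" where
  "barely_continuous_family X F \<longleftrightarrow>
     (\<forall>A. closedin X A \<and> A \<noteq> {} \<longrightarrow>
        (\<exists>a\<in>A. equicontinuous_at (subtopology X A) ((\<lambda>\<phi>. restrict \<phi> A) ` F) a))"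

definition G_invariant :: "('g, 'm) monoid_scheme \<Rightarrow> ('g \<Rightarrow> 'x \<Rightarrow> 'x) \<Rightarrow> 'x set \<Rightarrow> bool" where
  "G_invariant G \<phi> Y \<longleftrightarrow> (\<forall>g\<in>carrier G. \<phi> g ` Y \<subseteq> Y)"

definition generically_continuous_on ::
    "('g, 'm) monoid_scheme \<Rightarrow> 'x topology \<Rightarrow> ('g \<Rightarrow> 'x \<Rightarrow> 'x) \<Rightarrow> ('x \<Rightarrow> real) \<Rightarrow> 'x set \<Rightarrow> bool" where
  "generically_continuous_on G X \<phi> f Y \<longleftrightarrow>
     (\<exists>Y\<^sub>0. gdelta_in (subtopology X Y) Y\<^sub>0 \<and> subtopology X Y closure_of Y\<^sub>0 = Y \<and>
        (\<forall>p\<in>enveloping_semigroup G X \<phi>.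
           continuous_map (subtopology X Y\<^sub>0) euclideanreal (induced_map X f p)))"

end

theory Submission
  imports Defs
begin

text \<open>
  Each of the conditions amounts to saying that the translates \<open>x \<mapsto> f (g x)\<close>, \<open>g \<in> G\<close>,
  have common small oscillation somewhere on every nonempty subset of \<open>X\<close>. The family
  \<open>E\<^sup>f\<close> may be replaced by these translates, since an inequality \<open>\<bar>f (p x) - f (p y)\<bar> \<le> \<epsilon>\<close> that holds for all translations \<open>p\<close> passes to their
  pointwise limits (\<open>osc_le_enveloping_family\<close>).

  Fragmentation and generic continuity. In a closed \<open>Y\<close>, fragmentation makes the union of all
  relatively open sets of oscillation at most \<open>1/n\<close> dense; by Baire's theorem the intersection over
  \<open>n\<close> is a dense \<open>G\<^sub>\<delta>\<close> of points of equicontinuity. This gives bare continuity and generic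
  continuity at once (\<open>fragmented_imp_generically_equicontinuous\<close>). Bare continuity returns
  fragmentation when it is applied to the closure of the set to be fragmented.

  From invariant closed sets back to fragmentation. Let \<open>Y\<close> be the closure of the \<open>G\<close>-orbit of \<open>A\<close>.
  The evaluation \<open>(p, y) \<mapsto> f (p y)\<close> is separately continuous on \<open>E \<times> Y\<^sub>0\<close>, with \<open>E\<close> compact and \<open>Y\<^sub>0\<close>
  a dense \<open>G\<^sub>\<delta>\<close> in a compact space. A Namioka argument (\<open>separately_continuous_imp_small_open\<close>) yields
  a nonempty relatively open subset of \<open>Y\<close> on which all translates have small oscillation. It meets
  the orbit of \<open>A\<close>, and the set of all translates is itself invariant, so one translation carries it
  to an open set that meets \<open>A\<close>. This is why invariant closed sets suffice.

  Fragmentation and Asplund functions. If the translates are not fragmented, a binary tree of open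
  sets produces a Cantor set of points that countably many translates keep \<open>\<epsilon>\<close>-separated; the
  countable subgroup generated by the elements used then has a nonseparable pseudometric
  (\<open>not_fragmented_imp_separated_Cantor_set\<close>). Conversely, for countable \<open>H\<close> the maps \<open>f \<circ> h\<close>,
  \<open>h \<in> H\<close>, together send \<open>X\<close> onto a compact metrizable space; a minimal closed set with a prescribed image transfers
  fragmentation to that second countable space, where it implies separability
  (\<open>fragmented_countable_imp_separable\<close>).
\<close>

section \<open>Common oscillation and fragmented families\<close>

definition osc_le :: "('x \<Rightarrow> real) set \<Rightarrow> real \<Rightarrow> 'x set \<Rightarrow> bool" where
  "osc_le F \<epsilon> B \<longleftrightarrow> (\<forall>\<phi>\<in>F. \<forall>x\<in>B. \<forall>y\<in>B. \<bar>\<phi> x - \<phi> y\<bar> \<le> \<epsilon>)"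

lemma osc_leD: "osc_le F \<epsilon> B \<Longrightarrow> \<phi> \<in> F \<Longrightarrow> x \<in> B \<Longrightarrow> y \<in> B \<Longrightarrow> \<bar>\<phi> x - \<phi> y\<bar> \<le> \<epsilon>"
  by (simp add: osc_le_def)

lemma bounded_diameter_le_iff:
  fixes S :: "real set"
  assumes "0 \<le> \<epsilon>"
  shows "bounded S \<and> diameter S \<le> \<epsilon> \<longleftrightarrow> (\<forall>x\<in>S. \<forall>y\<in>S. \<bar>x - y\<bar> \<le> \<epsilon>)"
proof (intro iffI)
  assume *: "bounded S \<and> diameter S \<le> \<epsilon>"
  then show "\<forall>x\<in>S. \<forall>y\<in>S. \<bar>x - y\<bar> \<le> \<epsilon>"
    using diameter_bounded_bound[of S] by (force simp: dist_real_def)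
next
  assume *: "\<forall>x\<in>S. \<forall>y\<in>S. \<bar>x - y\<bar> \<le> \<epsilon>"
  show "bounded S \<and> diameter S \<le> \<epsilon>"
  proof
    show "bounded S"
    proof (cases "S = {}")
      case False
      then obtain a where "a \<in> S" by blast
      with * have "\<forall>y\<in>S. dist a y \<le> \<epsilon>" by (auto simp: dist_real_def)
      then show ?thesis unfolding bounded_def by blast
    qed simp
    show "diameter S \<le> \<epsilon>"
      using * assms by (intro diameter_le) (auto simp: real_norm_def)
  qed
qed

lemma fragmented_family_iff_osc_le:
  "fragmented_family X F \<longleftrightarrow>
     (\<forall>A \<epsilon>. A \<subseteq> topspace X \<and> A \<noteq> {} \<and> 0 < \<epsilon> \<longrightarrow>
        (\<exists>U. openin X U \<and> U \<inter> A \<noteq> {} \<and> osc_le F \<epsilon> (U \<inter> A)))"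
proof -
  have "(\<forall>\<phi>\<in>F. bounded (\<phi> ` B) \<and> diameter (\<phi> ` B) \<le> \<epsilon>) \<longleftrightarrow> osc_le F \<epsilon> B" if "0 < \<epsilon>" for \<epsilon> B
    using that by (simp add: bounded_diameter_le_iff osc_le_def)
  then show ?thesis
    unfolding fragmented_family_def
    by (intro all_cong1 imp_cong refl ex_cong1 conj_cong) simp_all
qed

lemma fragmented_familyD:
  assumes "fragmented_family X F" "A \<subseteq> topspace X" "A \<noteq> {}" "0 < \<epsilon>"
  obtains U where "openin X U" "U \<inter> A \<noteq> {}" "osc_le F \<epsilon> (U \<inter> A)"
proof -
  have "\<exists>U. openin X U \<and> U \<inter> A \<noteq> {} \<and> osc_le F \<epsilon> (U \<inter> A)"
    using assms(1)[unfolded fragmented_family_iff_osc_le, rule_format, of A \<epsilon>] assms(2-4) by simp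
  then show thesis using that by blast
qed

lemma fragmented_family_mono:
  "fragmented_family X F \<Longrightarrow> F' \<subseteq> F \<Longrightarrow> fragmented_family X F'"
  unfolding fragmented_family_def by (meson subsetD)

text \<open>A relatively open neighbourhood of a point of equicontinuity in the closure of \<open>A\<close> meets \<open>A\<close>.\<close>
lemma barely_continuous_imp_fragmented:
  assumes "barely_continuous_family X F"
  shows "fragmented_family X F"
  unfolding fragmented_family_iff_osc_le
proof (intro allI impI, elim conjE)
  fix A and \<epsilon> :: real
  assume A: "A \<subseteq> topspace X" "A \<noteq> {}" and \<epsilon>: "0 < \<epsilon>"
  let ?C = "X closure_of A"
  have AC: "A \<subseteq> ?C" using A by (simp add: closure_of_subset)
  then have "closedin X ?C" "?C \<noteq> {}" using A by auto
  then obtain a where a: "a \<in> ?C" "equicontinuous_at (subtopology X ?C) ((\<lambda>\<phi>. restrict \<phi> ?C) ` F) a"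
    using assms unfolding barely_continuous_family_def by blast
  then obtain V where V: "openin (subtopology X ?C) V" "a \<in> V"
    "\<And>\<phi> x. \<phi> \<in> F \<Longrightarrow> x \<in> V \<Longrightarrow> \<bar>restrict \<phi> ?C x - restrict \<phi> ?C a\<bar> < \<epsilon> / 2"
    using \<epsilon> unfolding equicontinuous_at_def by (metis half_gt_zero image_eqI)
  then obtain U where U: "openin X U" "V = U \<inter> ?C" by (auto simp: openin_subtopology)
  have "U \<inter> A \<noteq> {}" using V U a(1) by (meson IntD1 disjoint_iff in_closure_of)
  moreover have "osc_le F \<epsilon> (U \<inter> A)"
    unfolding osc_le_def
  proof (intro ballI)
    fix \<phi> x y assume "\<phi> \<in> F" and "x \<in> U \<inter> A" and "y \<in> U \<inter> A"
    then have "\<bar>\<phi> x - \<phi> a\<bar> < \<epsilon> / 2" "\<bar>\<phi> y - \<phi> a\<bar> < \<epsilon> / 2"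
      using V(3)[of \<phi> x] V(3)[of \<phi> y] U(2) a(1) AC by (auto simp: subset_iff)
    then show "\<bar>\<phi> x - \<phi> y\<bar> \<le> \<epsilon>" by linarith
  qed
  ultimately show "\<exists>U. openin X U \<and> U \<inter> A \<noteq> {} \<and> osc_le F \<epsilon> (U \<inter> A)" using U by blast
qed

text \<open>The points of \<open>Y\<close> that have, for each \<open>n\<close>, a relative neighbourhood of oscillation at most \<open>1/n\<close>
  are the points of equicontinuity. For fixed \<open>n\<close> they form an open set, which is dense because
  every nonempty relatively open set can be fragmented.\<close>
lemma fragmented_imp_generically_equicontinuous:
  assumes "compact_space X" "Hausdorff_space X" "fragmented_family X F" "closedin X Y"
  obtains Y\<^sub>0 where "gdelta_in (subtopology X Y) Y\<^sub>0" "subtopology X Y closure_of Y\<^sub>0 = Y"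
    "\<And>a. a \<in> Y\<^sub>0 \<Longrightarrow> equicontinuous_at (subtopology X Y) ((\<lambda>\<phi>. restrict \<phi> Y) ` F) a"
proof -
  let ?Z = "subtopology X Y"
  have YX: "Y \<subseteq> topspace X" and tZ: "topspace ?Z = Y"
    using assms(4) closedin_subset by (auto simp: topspace_subtopology_subset)
  have Z: "compact_space ?Z" "Hausdorff_space ?Z"
    using assms by (simp_all add: closedin_compact_space compact_space_subtopology Hausdorff_space_subtopology)
  define R where "R n = \<Union>{V. openin ?Z V \<and> osc_le F (1 / Suc n) V}" for n :: nat
  have Ro: "openin ?Z (R n)" for n unfolding R_def by blast
  have Rd: "?Z closure_of (R n) = topspace ?Z" for n
    unfolding dense_intersects_open
  proof (intro allI impI, elim conjE)
    fix W assume W: "openin ?Z W" "W \<noteq> {}"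
    then have "W \<subseteq> topspace X" using YX openin_subset tZ by fastforce
    then obtain U where U: "openin X U" "U \<inter> W \<noteq> {}" "osc_le F (1 / Suc n) (U \<inter> W)"
      using fragmented_familyD[OF assms(3), of W "1 / Suc n"] W(2) by auto
    have "openin ?Z (U \<inter> W)" 
      using U(1) W(1) by (auto simp: openin_subtopology Int_assoc[symmetric])
    then show "R n \<inter> W \<noteq> {}" using U unfolding R_def by blast
  qed
  show thesis
  proof (rule that)
    show "gdelta_in ?Z (\<Inter>(range R))"
      using Ro by (intro gdelta_in_Inter) (auto intro: open_imp_gdelta_in)
    show "?Z closure_of \<Inter>(range R) = Y"
      using Baire_category[of ?Z "range R"] Ro Rd Z tZ
      by (auto simp: compact_imp_locally_compact_space compact_Hausdorff_imp_regular_space)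
    fix a assume a: "a \<in> \<Inter>(range R)"
    show "equicontinuous_at ?Z ((\<lambda>\<phi>. restrict \<phi> Y) ` F) a"
      unfolding equicontinuous_at_def
    proof (intro allI impI)
      fix \<epsilon> :: real assume "0 < \<epsilon>"
      then obtain n :: nat where n: "1 / Suc n < \<epsilon>" using nat_approx_posE by blast
      from a obtain V where V: "openin ?Z V" "a \<in> V" "osc_le F (1 / Suc n) V"
        unfolding R_def by blast
      have "V \<subseteq> Y" using V tZ openin_subset by metis
      then have "\<bar>restrict \<phi> Y x - restrict \<phi> Y a\<bar> < \<epsilon>" if "\<phi> \<in> F" "x \<in> V" for \<phi> x
        using osc_leD[OF V(3) that V(2)] n V(2) that by (auto simp: subset_iff)
      then show "\<exists>U. openin ?Z U \<and> a \<in> U \<and> (\<forall>\<phi>\<in>(\<lambda>\<phi>. restrict \<phi> Y) ` F. \<forall>x\<in>U. \<bar>\<phi> x - \<phi> a\<bar> < \<epsilon>)"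
        using V(1,2) by blast
    qed
  qed
qed

lemma fragmented_imp_barely_continuous:
  assumes "compact_space X" "Hausdorff_space X" "fragmented_family X F"
  shows "barely_continuous_family X F"
  unfolding barely_continuous_family_def
proof (intro allI impI, elim conjE)
  fix Y assume Y: "closedin X Y" "Y \<noteq> {}"
  obtain Y\<^sub>0 where Y\<^sub>0: "subtopology X Y closure_of Y\<^sub>0 = Y" "gdelta_in (subtopology X Y) Y\<^sub>0"
    "\<And>a. a \<in> Y\<^sub>0 \<Longrightarrow> equicontinuous_at (subtopology X Y) ((\<lambda>\<phi>. restrict \<phi> Y) ` F) a"
    using fragmented_imp_generically_equicontinuous[OF assms Y(1)] by metis
  then have "Y\<^sub>0 \<noteq> {}" "Y\<^sub>0 \<subseteq> Y" using Y(2) gdelta_in_subset by fastforce+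
  then show "\<exists>a\<in>Y. equicontinuous_at (subtopology X Y) ((\<lambda>\<phi>. restrict \<phi> Y) ` F) a"
    using Y\<^sub>0(3) by blast
qed

lemma equicontinuous_at_imp_continuous_map:
  assumes "Y\<^sub>0 \<subseteq> Y" "\<phi> \<in> F"
    and "\<And>a. a \<in> Y\<^sub>0 \<Longrightarrow> equicontinuous_at (subtopology X Y) ((\<lambda>\<phi>. restrict \<phi> Y) ` F) a"
  shows "continuous_map (subtopology X Y\<^sub>0) euclideanreal \<phi>"
  unfolding Met_TC.continuous_map_to_metric[of _ \<phi>, simplified]
proof (intro ballI allI impI)
  fix a and \<epsilon> :: real assume a: "a \<in> topspace (subtopology X Y\<^sub>0)" and "0 < \<epsilon>"
  then obtain V where V: "openin (subtopology X Y) V" "a \<in> V"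
    "\<And>\<psi> x. \<psi> \<in> F \<Longrightarrow> x \<in> V \<Longrightarrow> \<bar>restrict \<psi> Y x - restrict \<psi> Y a\<bar> < \<epsilon>"
    using assms(3)[of a] unfolding equicontinuous_at_def by auto
  then obtain U where U: "openin X U" "V = U \<inter> Y" by (auto simp: openin_subtopology)
  have "dist (\<phi> a) (\<phi> y) < \<epsilon>" if "y \<in> U \<inter> Y\<^sub>0" for y
    using V(3)[OF assms(2), of y] that U assms(1) a by (auto simp: dist_real_def abs_minus_commute subset_iff)
  moreover have "openin (subtopology X Y\<^sub>0) (U \<inter> Y\<^sub>0)" using U by (auto simp: openin_subtopology)
  ultimately show "\<exists>U. openin (subtopology X Y\<^sub>0) U \<and> a \<in> U \<and> (\<forall>y\<in>U. dist (\<phi> a) (\<phi> y) < \<epsilon>)"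
    using a V(2) U(2) by (intro exI[of _ "U \<inter> Y\<^sub>0"]) auto
qed

section \<open>Points separated by countably many functions\<close>

lemma uncountable_binary_sequences: "uncountable (UNIV :: (nat \<Rightarrow> bool) set)"
proof
  assume "countable (UNIV :: (nat \<Rightarrow> bool) set)"
  then obtain e :: "nat \<Rightarrow> nat \<Rightarrow> bool" where e: "range e = UNIV"
    using range_from_nat_into by (metis UNIV_not_empty)
  then obtain n where "e n = (\<lambda>k. \<not> e k k)" by (metis rangeE UNIV_I)
  then show False by meson
qed

lemma regular_space_shrink:
  assumes "regular_space X" "openin X U" "x \<in> U"
  obtains V where "openin X V" "x \<in> V" "X closure_of V \<subseteq> U"
proof -
  have "neighbourhood_base_of (closedin X) X" using assms(1) by (simp add: neighbourhood_base_of_closedin)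
  then obtain V C where "openin X V" "closedin X C" "x \<in> V" "V \<subseteq> C" "C \<subseteq> U"
    using assms(2,3) unfolding neighbourhood_base_of by metis
  then show thesis using that closure_of_minimal by (metis subset_trans)
qed
text \<open>If no open set meeting \<open>A\<close> has oscillation at most \<open>\<epsilon>\<close> on \<open>A\<close>, every such open set contains the
  closures of two others that also meet \<open>A\<close> and that a single \<open>\<phi> \<in> F\<close> keeps more than \<open>\<epsilon>\<close> apart.
  Iteration gives a binary tree: the nodes are countable in number, hence so is the set of functions
  used, while compactness puts a point at the end of each of the uncountably many branches.\<close>
lemma not_fragmented_imp_separated_Cantor_set:
  assumes X: "compact_space X" "Hausdorff_space X"
    and cont: "\<And>\<phi>. \<phi> \<in> F \<Longrightarrow> continuous_map X euclideanreal \<phi>"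
    and nf: "\<not> fragmented_family X F"
  obtains C \<epsilon> and x :: "(nat \<Rightarrow> bool) \<Rightarrow> 'x" where "countable C" "C \<subseteq> F" "0 < \<epsilon>"
    "\<And>\<sigma>. x \<sigma> \<in> topspace X"
    "\<And>\<sigma> \<tau>. \<sigma> \<noteq> \<tau> \<Longrightarrow> \<exists>\<phi>\<in>C. \<epsilon> < \<bar>\<phi> (x \<sigma>) - \<phi> (x \<tau>)\<bar>"
proof -
  have reg: "regular_space X" using X by (simp add: compact_Hausdorff_imp_regular_space)
  obtain A \<epsilon> where A: "A \<subseteq> topspace X" "A \<noteq> {}" and \<epsilon>: "0 < \<epsilon>"
    and big: "\<And>U. openin X U \<Longrightarrow> U \<inter> A \<noteq> {} \<Longrightarrow> \<not> osc_le F \<epsilon> (U \<inter> A)"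
    using nf unfolding fragmented_family_iff_osc_le by metis
  define P where "P U \<longleftrightarrow> openin X U \<and> U \<inter> A \<noteq> {}" for U
  have "\<exists>\<phi> V W. \<phi> \<in> F \<and> P V \<and> P W \<and> X closure_of V \<subseteq> U \<and> X closure_of W \<subseteq> U \<and>
      (\<forall>x\<in>X closure_of V. \<forall>y\<in>X closure_of W. \<epsilon> < \<bar>\<phi> x - \<phi> y\<bar>)" if "P U" for U
  proof -
    have "\<exists>\<phi>\<in>F. \<exists>x\<in>U \<inter> A. \<exists>y\<in>U \<inter> A. \<epsilon> < \<bar>\<phi> x - \<phi> y\<bar>"
      using big[of U] that by (simp add: P_def osc_le_def not_le)
    then obtain \<phi> x y where \<phi>: "\<phi> \<in> F" and xy: "x \<in> U \<inter> A" "y \<in> U \<inter> A" and d: "\<epsilon> < \<bar>\<phi> x - \<phi> y\<bar>"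
      by blast
    \<comment> \<open>half of the excess over \<open>\<epsilon>\<close>: both values may move by this much and still differ by more than \<open>\<epsilon>\<close>\<close>
    define \<delta> where "\<delta> = (\<bar>\<phi> x - \<phi> y\<bar> - \<epsilon>) / 2"
    have \<delta>: "0 < \<delta>" using d by (simp add: \<delta>_def)
    have nb: "\<exists>V. P V \<and> X closure_of V \<subseteq> U \<inter> {w. \<bar>\<phi> w - \<phi> z\<bar> < \<delta>}" if z: "z \<in> U \<inter> A" for z
    proof -
      have "openin X {w \<in> topspace X. \<phi> w \<in> ball (\<phi> z) \<delta>}"
        using cont[OF \<phi>] by (rule openin_continuous_map_preimage) auto
      then have "openin X (U \<inter> {w \<in> topspace X. \<phi> w \<in> ball (\<phi> z) \<delta>})"
        using \<open>P U\<close> unfolding P_def by blast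
      moreover have "z \<in> U \<inter> {w \<in> topspace X. \<phi> w \<in> ball (\<phi> z) \<delta>}" using z A \<delta> by auto
      ultimately obtain V where V: "openin X V" "z \<in> V"
          "X closure_of V \<subseteq> U \<inter> {w \<in> topspace X. \<phi> w \<in> ball (\<phi> z) \<delta>}"
        by (rule regular_space_shrink[OF reg])
      have "P V" using V z unfolding P_def by blast
      then show ?thesis using V(3)
        by (intro exI[of _ V]) (auto simp: dist_real_def abs_minus_commute)
    qed
    obtain V where V: "P V" "X closure_of V \<subseteq> U \<inter> {w. \<bar>\<phi> w - \<phi> x\<bar> < \<delta>}" using nb xy by blast
    obtain W where W: "P W" "X closure_of W \<subseteq> U \<inter> {w. \<bar>\<phi> w - \<phi> y\<bar> < \<delta>}" using nb xy by blast
    have "\<epsilon> < \<bar>\<phi> v - \<phi> w\<bar>" if "v \<in> X closure_of V" "w \<in> X closure_of W" for v w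
    proof -
      have "\<bar>\<phi> v - \<phi> x\<bar> < \<delta>" "\<bar>\<phi> w - \<phi> y\<bar> < \<delta>" using that V W by auto
      then show ?thesis unfolding \<delta>_def by argo
    qed
    then show ?thesis using \<phi> V W by blast
  qed
  then obtain \<psi> V W where step: "\<And>U. P U \<Longrightarrow> \<psi> U \<in> F \<and> P (V U) \<and> P (W U) \<and>
      X closure_of (V U) \<subseteq> U \<and> X closure_of (W U) \<subseteq> U \<and>
      (\<forall>x\<in>X closure_of (V U). \<forall>y\<in>X closure_of (W U). \<epsilon> < \<bar>\<psi> U x - \<psi> U y\<bar>)"
    by metis
  define T where "T = rec_list (topspace X) (\<lambda>b _ U. if b then V U else W U)"
  have T0: "T [] = topspace X" and TC: "T (b # s) = (if b then V (T s) else W (T s))" for b s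
    by (simp_all add: T_def)
  have PT: "P (T s)" for s
  proof (induction s)
    case Nil then show ?case using A by (auto simp: T0 P_def)
  next
    case (Cons b s) then show ?case using step by (simp add: TC)
  qed
  have sub: "X closure_of T (b # s) \<subseteq> T s" for b s using step[OF PT] by (simp add: TC)
  \<comment> \<open>the latest choice comes first in the list, since the tree recurses on the tail\<close>
  define path where "path \<sigma> n = rev (map \<sigma> [0..<n])" for \<sigma> :: "nat \<Rightarrow> bool" and n
  have pS: "path \<sigma> (Suc n) = \<sigma> n # path \<sigma> n" for \<sigma> n by (simp add: path_def)
  have "(\<Inter>n. X closure_of T (path \<sigma> n)) \<noteq> {}" for \<sigma>
  proof (rule compact_space_imp_nest[OF X(1)])
    fix n
    show "closedin X (X closure_of T (path \<sigma> n))" by simp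
    show "X closure_of T (path \<sigma> n) \<noteq> {}"
      using PT[of "path \<sigma> n"] openin_subset[of X "T (path \<sigma> n)"] unfolding P_def
      by (auto simp: closure_of_eq_empty)
  next
    show "decseq (\<lambda>n. X closure_of T (path \<sigma> n))"
    proof (rule decseq_SucI)
      fix n
      have "T (path \<sigma> n) \<subseteq> X closure_of T (path \<sigma> n)"
        using PT[of "path \<sigma> n"] unfolding P_def by (intro closure_of_subset openin_subset) simp
      then show "X closure_of T (path \<sigma> (Suc n)) \<subseteq> X closure_of T (path \<sigma> n)"
        using sub[of "\<sigma> n" "path \<sigma> n"] unfolding pS by order
    qed
  qed
  then have "\<exists>y. \<forall>n. y \<in> X closure_of T (path \<sigma> n)" for \<sigma> by blast
  then obtain x where x: "\<And>\<sigma> n. x \<sigma> \<in> X closure_of T (path \<sigma> n)" by metis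
  have sep: "\<exists>\<phi>\<in>range (\<psi> \<circ> T). \<epsilon> < \<bar>\<phi> (x \<sigma>) - \<phi> (x \<tau>)\<bar>" if "\<sigma> \<noteq> \<tau>" for \<sigma> \<tau>
  proof -
    \<comment> \<open>the two branches part at the node reached after \<open>n\<close> choices, whose function separates them\<close>
    define n where "n = (LEAST n. \<sigma> n \<noteq> \<tau> n)"
    have "\<exists>n. \<sigma> n \<noteq> \<tau> n" using that by auto
    then have n: "\<sigma> n \<noteq> \<tau> n" unfolding n_def by (rule LeastI_ex)
    have "\<sigma> k = \<tau> k" if "k < n" for k using that not_less_Least unfolding n_def by blast
    then have p: "path \<sigma> n = path \<tau> n" by (simp add: path_def)
    let ?U = "T (path \<tau> n)"
    have "x \<sigma> \<in> X closure_of T (\<sigma> n # path \<tau> n)" "x \<tau> \<in> X closure_of T (\<tau> n # path \<tau> n)"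
      using x[of \<sigma> "Suc n"] x[of \<tau> "Suc n"] by (simp_all add: pS p)
    then have "\<epsilon> < \<bar>\<psi> ?U (x \<sigma>) - \<psi> ?U (x \<tau>)\<bar>"
      using step[OF PT[of "path \<tau> n"]] n
      by (cases "\<sigma> n"; cases "\<tau> n") (auto simp: TC abs_minus_commute)
    then show ?thesis by auto
  qed
  show thesis
  proof (rule that[OF _ _ \<epsilon> _ sep])
    show "countable (range (\<psi> \<circ> T))" by simp
    show "range (\<psi> \<circ> T) \<subseteq> F" using step PT by auto
    show "x \<sigma> \<in> topspace X" for \<sigma> using x[of \<sigma> 0] in_closure_of by fast
  qed
qed

section \<open>Separability from fragmentation by countably many functions\<close>

text \<open>The countable family \<open>F\<close> induces a second countable topology on \<open>X\<close>; call a set good if countably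
  many points approximate it within \<open>\<epsilon>\<close>. Removing all good basic open sets leaves a closed set \<open>C\<close>
  no nonempty basic part of which is good, so it must be shown that \<open>C\<close> is empty. Fragmentation
  refers to the original open sets, which are not open for the coarser topology. The remedy is a
  minimal closed set \<open>Z \<subseteq> C\<close> that still contains a representative of every fibre of \<open>F\<close> in \<open>C\<close>: by
  minimality, an open set meeting \<open>Z\<close> contains all representatives in \<open>Z\<close> of some fibre, and hence
  those of all fibres in a whole basic open set.\<close>
lemma fragmented_countable_imp_separable:
  assumes X: "compact_space X"
    and cont: "\<And>\<phi>. \<phi> \<in> F \<Longrightarrow> continuous_map X euclideanreal \<phi>"
    and F: "countable F" "fragmented_family X F" and \<epsilon>: "0 < \<epsilon>"
  obtains D where "countable D" "D \<subseteq> topspace X"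
    "\<And>x. x \<in> topspace X \<Longrightarrow> \<exists>y\<in>D. \<forall>\<phi>\<in>F. \<bar>\<phi> x - \<phi> y\<bar> \<le> \<epsilon>"
proof -
  define good where "good B \<longleftrightarrow>
    (\<exists>D. countable D \<and> D \<subseteq> topspace X \<and> (\<forall>x\<in>B. \<exists>y\<in>D. \<forall>\<phi>\<in>F. \<bar>\<phi> x - \<phi> y\<bar> \<le> \<epsilon>))" for B
  have good_Union: "good (\<Union>\<C>)" if \<C>: "countable \<C>" "\<And>B. B \<in> \<C> \<Longrightarrow> good B" for \<C>
  proof -
    obtain D where D: "\<And>B. B \<in> \<C> \<Longrightarrow> countable (D B) \<and> D B \<subseteq> topspace X \<and>
        (\<forall>x\<in>B. \<exists>y\<in>D B. \<forall>\<phi>\<in>F. \<bar>\<phi> x - \<phi> y\<bar> \<le> \<epsilon>)"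
      using \<C>(2) unfolding good_def by metis
    show ?thesis unfolding good_def
    proof (intro exI[of _ "\<Union>(D ` \<C>)"] conjI ballI)
      show "countable (\<Union>(D ` \<C>))" using D \<C>(1) by blast
      show "\<Union>(D ` \<C>) \<subseteq> topspace X" using D by blast
      fix x assume "x \<in> \<Union>\<C>"
      then obtain B where B: "B \<in> \<C>" "x \<in> B" by blast
      then obtain y where "y \<in> D B" "\<forall>\<phi>\<in>F. \<bar>\<phi> x - \<phi> y\<bar> \<le> \<epsilon>" using D[of B] by blast
      then show "\<exists>y\<in>\<Union>(D ` \<C>). \<forall>\<phi>\<in>F. \<bar>\<phi> x - \<phi> y\<bar> \<le> \<epsilon>" using B(1) by blast
    qed
  qed

  define \<H> where "\<H> = (\<lambda>(\<phi>, c). {x \<in> topspace X. \<phi> x < c}) ` (F \<times> \<rat>)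
    \<union> (\<lambda>(\<phi>, c). {x \<in> topspace X. c < \<phi> x}) ` (F \<times> \<rat>)"
  define \<B> where "\<B> = (\<lambda>I. topspace X \<inter> \<Inter>I) ` {I. finite I \<and> I \<subseteq> \<H>}"
  have lo: "openin X {x \<in> topspace X. \<phi> x < c}" if "\<phi> \<in> F" for \<phi> c
    using openin_continuous_map_preimage[OF cont[OF that], of "{..<c}"] by simp
  have hi: "openin X {x \<in> topspace X. c < \<phi> x}" if "\<phi> \<in> F" for \<phi> c
    using openin_continuous_map_preimage[OF cont[OF that], of "{c<..}"] by simp
  have "countable \<H>"
    unfolding \<H>_def using F(1) by (intro countable_Un countable_image countable_SIGMA countable_rat) auto
  then have cB: "countable \<B>"
    unfolding \<B>_def by (intro countable_image countable_Collect_finite_subset)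
  have oH: "openin X H" if "H \<in> \<H>" for H
    using that lo hi unfolding \<H>_def by auto
  have oB: "openin X B" if B: "B \<in> \<B>" for B
  proof -
    obtain I where I: "finite I" "I \<subseteq> \<H>" "B = topspace X \<inter> \<Inter>I" using B unfolding \<B>_def by blast
    have "openin X (topspace X \<inter> \<Inter>I)"
      using I(1,2) by (induction I) (auto simp: Int_assoc Int_left_commute dest!: oH intro!: openin_Int)
    then show ?thesis using I(3) by simp
  qed
  define same where "same x y \<longleftrightarrow> (\<forall>\<phi>\<in>F. \<phi> x = \<phi> y)" for x y
  have same_sym: "same y x" if "same x y" for x y
    using that unfolding same_def by metis
  have satH: "y \<in> H" if "H \<in> \<H>" "x \<in> H" "y \<in> topspace X" "same x y" for H x y
    using that unfolding \<H>_def same_def by auto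
  have satB: "y \<in> B" if "B \<in> \<B>" "x \<in> B" "y \<in> topspace X" "same x y" for B x y
    using that satH unfolding \<B>_def by blast

  have sepH: "\<exists>H\<in>\<H>. \<exists>N. openin X N \<and> z \<in> H \<and> k \<in> N \<and> N \<inter> H = {}"
    if zk: "z \<in> topspace X" "k \<in> topspace X" "\<not> same z k" for z k
  proof -
    obtain \<phi> where \<phi>: "\<phi> \<in> F" "\<phi> z \<noteq> \<phi> k" using zk(3) unfolding same_def by blast
    show ?thesis
    proof (cases "\<phi> z < \<phi> k")
      case True
      then obtain c where c: "c \<in> \<rat>" "\<phi> z < c" "c < \<phi> k" using Rats_dense_in_real by blast
      have "{x \<in> topspace X. \<phi> x < c} \<in> \<H>" unfolding \<H>_def using c(1) \<phi>(1) by force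
      then show ?thesis
        using c zk hi[OF \<phi>(1), of c]
        by (intro bexI[of _ "{x \<in> topspace X. \<phi> x < c}"] exI[of _ "{x \<in> topspace X. c < \<phi> x}"]) auto
    next
      case False
      then have "\<phi> k < \<phi> z" using \<phi>(2) by simp
      then obtain c where c: "c \<in> \<rat>" "\<phi> k < c" "c < \<phi> z" using Rats_dense_in_real by blast
      have "{x \<in> topspace X. c < \<phi> x} \<in> \<H>" unfolding \<H>_def using c(1) \<phi>(1) by force
      then show ?thesis
        using c zk lo[OF \<phi>(1), of c]
        by (intro bexI[of _ "{x \<in> topspace X. c < \<phi> x}"] exI[of _ "{x \<in> topspace X. \<phi> x < c}"]) auto
    qed
  qed
  have sepB: "\<exists>B\<in>\<B>. z \<in> B \<and> B \<inter> K = {}"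
    if z: "z \<in> topspace X" and K: "closedin X K" and ns: "\<And>k. k \<in> K \<Longrightarrow> \<not> same z k" for z K
  proof -
    have KX: "K \<subseteq> topspace X" using K by (rule closedin_subset)
    let ?P = "{N. openin X N \<and> (\<exists>H\<in>\<H>. z \<in> H \<and> N \<inter> H = {})}"
    have "K \<subseteq> \<Union>?P"
    proof
      fix k assume k: "k \<in> K"
      have "k \<in> topspace X" using k KX by (rule subsetD[rotated])
      then obtain H N where HN: "H \<in> \<H>" "openin X N" "z \<in> H" "k \<in> N" "N \<inter> H = {}"
        using sepH[OF z _ ns[OF k]] by metis
      then have "N \<in> ?P" by blast
      then show "k \<in> \<Union>?P" using HN(4) by (rule UnionI)
    qed
    then obtain \<F> where \<F>: "finite \<F>" "\<F> \<subseteq> ?P" "K \<subseteq> \<Union>\<F>"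
      using compactinD[OF closedin_compact_space[OF X K], of ?P] by blast
    then have "\<And>N. N \<in> \<F> \<Longrightarrow> \<exists>H. H \<in> \<H> \<and> z \<in> H \<and> N \<inter> H = {}" by blast
    then obtain h where h: "\<And>N. N \<in> \<F> \<Longrightarrow> h N \<in> \<H> \<and> z \<in> h N \<and> N \<inter> h N = {}" by metis
    let ?B = "topspace X \<inter> \<Inter>(h ` \<F>)"
    have "?B \<in> \<B>" unfolding \<B>_def using \<F>(1) h by (intro imageI) auto
    moreover have "z \<in> ?B" using z h by blast
    moreover have "?B \<inter> K = {}" using \<F>(3) h by blast
    ultimately show ?thesis by blast
  qed

  define W where "W = \<Union>{B \<in> \<B>. good B}"
  have gW: "good W" unfolding W_def using cB by (intro good_Union) auto
  define C where "C = topspace X - W"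
  have C: "closedin X C" unfolding C_def W_def using oB by blast
  have "C = {}"
  proof (rule ccontr)
    assume "C \<noteq> {}"
    \<comment> \<open>the open sets whose removal from \<open>C\<close> leaves a representative of each fibre; the complement of a
      maximal one is the minimal closed set\<close>
    define \<A> where "\<A> = {N. openin X N \<and> (\<forall>c\<in>C. \<exists>z\<in>C - N. same z c)}"
    have "\<exists>M\<in>\<A>. \<forall>N\<in>\<A>. M \<subseteq> N \<longrightarrow> N = M"
    proof (rule subset_Zorn_nonempty)
      have "{} \<in> \<A>" unfolding \<A>_def same_def by auto
      then show "\<A> \<noteq> {}" by blast
    next
      fix \<C> assume \<C>: "\<C> \<noteq> {}" "subset.chain \<A> \<C>"
      then have CA: "\<C> \<subseteq> \<A>" by (simp add: subset_chain_def)
      have "\<exists>z\<in>C - \<Union>\<C>. same z c" if c: "c \<in> C" for c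
      proof (rule ccontr)
        assume neg: "\<not> (\<exists>z\<in>C - \<Union>\<C>. same z c)"
        \<comment> \<open>the fibre of \<open>c\<close> in \<open>C\<close>; by compactness, a chain that covers it has a member that does\<close>
        let ?K = "C - (\<Union>\<phi>\<in>F. {x \<in> topspace X. \<phi> x < \<phi> c} \<union> {x \<in> topspace X. \<phi> c < \<phi> x})"
        have "closedin X ?K"
          using C lo hi by (intro closedin_diff openin_Union) (auto intro!: openin_Un)
        moreover have "?K \<subseteq> \<Union>\<C>"
        proof
          fix x assume x: "x \<in> ?K"
          then have "x \<in> topspace X" using C_def by blast
          then have "same x c" using x unfolding same_def by (auto simp: not_less intro: antisym)
          then show "x \<in> \<Union>\<C>" using neg x by blast
        qed
        ultimately obtain \<F> where \<F>: "finite \<F>" "\<F> \<subseteq> \<C>" "?K \<subseteq> \<Union>\<F>"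
          using compactinD[OF closedin_compact_space[OF X], of ?K \<C>] CA unfolding \<A>_def by blast
        have "\<exists>N\<in>\<C>. \<Union>\<F> \<subseteq> N"
          using \<F>(1,2)
        proof (induction \<F>)
          case empty
          then show ?case using \<C>(1) by blast
        next
          case (insert P \<F>)
          from insert.IH insert.prems obtain N where N: "N \<in> \<C>" "\<Union>\<F> \<subseteq> N" by auto
          have P: "P \<in> \<C>" using insert.prems by simp
          have "P \<subseteq> N \<or> N \<subseteq> P"
            using \<C>(2) N(1) P unfolding subset_chain_def by simp
          then show ?case
          proof
            assume "P \<subseteq> N"
            then show ?thesis using N by (intro bexI[of _ N]) auto
          next
            assume "N \<subseteq> P"
            then show ?thesis using N P by (intro bexI[of _ P]) auto
          qed
        qed
        then obtain N where N: "N \<in> \<C>" "\<Union>\<F> \<subseteq> N" by (elim bexE)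
        have "N \<in> \<A>" using CA N(1) by (rule subsetD)
        then obtain z where z: "z \<in> C" "z \<notin> N" "same z c" using c unfolding \<A>_def by auto
        then have "z \<in> ?K" unfolding same_def by auto
        then have "z \<in> N" using \<F>(3) N(2) by (meson subsetD)
        then show False using z(2) by contradiction
      qed
      moreover have "openin X (\<Union>\<C>)" using CA unfolding \<A>_def by (intro openin_Union) auto
      ultimately show "\<Union>\<C> \<in> \<A>" unfolding \<A>_def by simp
    qed
    then obtain M where M: "M \<in> \<A>" and max: "\<And>N. N \<in> \<A> \<Longrightarrow> M \<subseteq> N \<Longrightarrow> N = M" by blast
    have oM: "openin X M" and hit: "\<And>c. c \<in> C \<Longrightarrow> \<exists>z\<in>C - M. same z c"
      using M unfolding \<A>_def by auto
    have "C - M \<noteq> {}" "C - M \<subseteq> topspace X" using hit \<open>C \<noteq> {}\<close> C_def by blast+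
    then obtain U where U: "openin X U" "U \<inter> (C - M) \<noteq> {}" "osc_le F \<epsilon> (U \<inter> (C - M))"
      using fragmented_familyD[OF F(2) _ _ \<epsilon>] by metis
    \<comment> \<open>by maximality some fibre has its representatives only inside \<open>U\<close>\<close>
    have "M \<union> U \<notin> \<A>" using max[of "M \<union> U"] U(2) by blast
    then obtain c where c: "c \<in> C" "\<And>z. z \<in> C - (M \<union> U) \<Longrightarrow> \<not> same z c"
      using oM U(1) unfolding \<A>_def by blast
    have cX: "c \<in> topspace X" using c(1) C_def by blast
    have cl: "closedin X (C - (M \<union> U))" using C oM U(1) by blast
    have ns: "\<not> same c k" if "k \<in> C - (M \<union> U)" for k
      using c(2)[OF that] same_sym by blast
    then obtain B where B: "B \<in> \<B>" "c \<in> B" "B \<inter> (C - (M \<union> U)) = {}"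
      using sepB[OF cX cl ns] by blast
    obtain y where y: "y \<in> C - M" "same y c" using hit c(1) by blast
    have yX: "y \<in> topspace X" using y C_def by blast
    have yU: "y \<in> U"
    proof -
      have "same c y" using y(2) by (rule same_sym)
      then show ?thesis using satB[OF B(1,2) yX] y(1) B(3) by blast
    qed
    have "\<bar>\<phi> x - \<phi> y\<bar> \<le> \<epsilon>" if x: "x \<in> B \<inter> C" and \<phi>: "\<phi> \<in> F" for x \<phi>
    proof -
      obtain z where z: "z \<in> C - M" "same z x" using hit x by blast
      have "same x z" using z(2) by (rule same_sym)
      moreover have "z \<in> topspace X" using z(1) C_def by blast
      ultimately have "z \<in> B" using satB[OF B(1), of x z] x by blast
      then have "z \<in> U \<inter> (C - M)" using z B(3) by blast
      moreover have "\<phi> z = \<phi> x" using z \<phi> unfolding same_def by blast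
      ultimately show ?thesis using osc_leD[OF U(3) \<phi>, of z y] y yU by simp
    qed
    then have "good (B \<inter> C)" unfolding good_def using yX by (intro exI[of _ "{y}"]) auto
    moreover have "B \<subseteq> \<Union>{W, B \<inter> C}" using openin_subset[OF oB[OF B(1)]] C_def by blast
    moreover have "good (\<Union>{W, B \<inter> C})"
      by (rule good_Union) (use gW calculation(1) in auto)
    ultimately have "good B" unfolding good_def by (meson subsetD)
    then have "c \<in> W" using B unfolding W_def by blast
    then show False using c(1) C_def by blast
  qed
  then have "topspace X \<subseteq> W" using C_def by blast
  then show thesis using gW that unfolding good_def by (meson subsetD)
qed

section \<open>Small open sets from separate continuity\<close>

text \<open>Only finitely many cells of a grid of mesh \<open>\<eta>\<close> in \<open>\<real>\<^sup>S\<close> are met by the value vectors; one index is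
  picked for each.\<close>
lemma pointwise_bounded_imp_finite_net:
  fixes e :: "'k \<Rightarrow> 'x \<Rightarrow> real"
  assumes "finite S" "0 < \<eta>" "\<And>a. a \<in> S \<Longrightarrow> bounded ((\<lambda>g. e g a) ` D)"
  obtains N where "finite N" "N \<subseteq> D" "\<And>g. g \<in> D \<Longrightarrow> \<exists>h\<in>N. \<forall>a\<in>S. \<bar>e g a - e h a\<bar> < \<eta>"
proof -
  define r where "r g = (\<lambda>a\<in>S. \<lfloor>e g a / \<eta>\<rfloor>)" for g
  have "finite ((\<lambda>g. \<lfloor>e g a / \<eta>\<rfloor>) ` D)" if a: "a \<in> S" for a
  proof -
    obtain B where "\<forall>x\<in>(\<lambda>g. e g a) ` D. norm x \<le> B"
      using assms(3)[OF a] unfolding bounded_iff by (elim exE)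
    then have B: "\<And>g. g \<in> D \<Longrightarrow> \<bar>e g a\<bar> \<le> B" by simp
    have "(\<lambda>g. \<lfloor>e g a / \<eta>\<rfloor>) ` D \<subseteq> {\<lfloor>- B / \<eta>\<rfloor>..\<lfloor>B / \<eta>\<rfloor>}"
    proof (clarsimp, intro conjI floor_mono)
      fix g assume "g \<in> D"
      then have "- B \<le> e g a" "e g a \<le> B" using B[of g] by linarith+
      then show "- (B / \<eta>) \<le> e g a / \<eta>" "e g a / \<eta> \<le> B / \<eta>"
        using assms(2) by (simp_all add: field_simps)
    qed
    then show ?thesis by (rule finite_subset) simp
  qed
  then have "finite (PiE S (\<lambda>a. (\<lambda>g. \<lfloor>e g a / \<eta>\<rfloor>) ` D))"
    using assms(1) by (intro finite_PiE) auto
  moreover have "r ` D \<subseteq> PiE S (\<lambda>a. (\<lambda>g. \<lfloor>e g a / \<eta>\<rfloor>) ` D)"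
    unfolding r_def by auto
  ultimately have "finite (r ` D)" by (rule finite_subset[rotated])
  then obtain N where N: "N \<subseteq> D" "finite N" "r ` D = r ` N"
    using finite_subset_image[of "r ` D" r D] by auto
  show thesis
  proof (rule that[OF N(2,1)])
    fix g assume "g \<in> D"
    then have "r g \<in> r ` N" using N(3) by blast
    then obtain h where h: "h \<in> N" "r g = r h" by blast
    have "\<bar>e g a - e h a\<bar> < \<eta>" if a: "a \<in> S" for a
    proof -
      have "\<lfloor>e g a / \<eta>\<rfloor> = \<lfloor>e h a / \<eta>\<rfloor>" using fun_cong[OF h(2), of a] a by (simp add: r_def)
      then have "\<bar>e g a / \<eta> - e h a / \<eta>\<bar> < 1" by linarith
      then have "\<bar>(e g a - e h a) / \<eta>\<bar> < 1" by (simp add: diff_divide_distrib)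
      then show ?thesis using assms(2) by (simp add: abs_divide divide_less_eq)
    qed
    then show "\<exists>h\<in>N. \<forall>a\<in>S. \<bar>e g a - e h a\<bar> < \<eta>" using h(1) by blast
  qed
qed

text \<open>A form of Namioka's theorem, proved by Saint Raymond's construction. Suppose there is no small open
  set. Given an open \<open>V\<close> and finitely many points, there are \<open>u, v \<in> D\<close> that nearly agree at these
  points and yet differ by more than \<open>\<delta>\<close> somewhere in \<open>V\<close>: otherwise finitely many members of \<open>D\<close>
  would approximate all of \<open>D\<close> uniformly on \<open>V\<close>, and their continuity would produce a small open
  set. Repeating this inside shrinking sets \<open>V n\<close>, with a new point \<open>a n\<close> of \<open>Z\<^sub>0\<close> each time, a limit
  pair \<open>(p, q)\<close> agrees at all \<open>a n\<close> but differs by at least \<open>\<delta>\<close> at a cluster point \<open>z\<close> of them. The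
  intersection of the \<open>V n\<close> lies in \<open>Z\<^sub>0\<close>, so \<open>z\<close> is in \<open>Z\<^sub>0\<close>, where \<open>p\<close> and \<open>q\<close> are continuous, and this is
  a contradiction.\<close>
lemma separately_continuous_imp_small_open:
  fixes e :: "'k \<Rightarrow> 'x \<Rightarrow> real"
  assumes K: "compact_space K" and Z: "compact_space Z" "Hausdorff_space Z" "topspace Z \<noteq> {}"
    and D: "D \<subseteq> topspace K"
    and ev: "\<And>x. x \<in> topspace Z \<Longrightarrow> continuous_map K euclideanreal (\<lambda>p. e p x)"
    and cont: "\<And>g. g \<in> D \<Longrightarrow> continuous_map Z euclideanreal (e g)"
    and Z0: "gdelta_in Z Z\<^sub>0" "Z closure_of Z\<^sub>0 = topspace Z"
    and cont0: "\<And>p. p \<in> topspace K \<Longrightarrow> continuous_map (subtopology Z Z\<^sub>0) euclideanreal (e p)"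
    and \<epsilon>: "0 < \<epsilon>"
  obtains U where "openin Z U" "U \<noteq> {}" "osc_le (e ` D) \<epsilon> U"
proof (rule ccontr)
  note found = that
  assume contra: "\<not> thesis"
  have none: "\<not> osc_le (e ` D) \<epsilon> U" if "openin Z U" "U \<noteq> {}" for U
    using found[OF that] contra by blast
  have reg: "regular_space Z" using Z by (simp add: compact_Hausdorff_imp_regular_space)
  have Z0Z: "Z\<^sub>0 \<subseteq> topspace Z" using Z0(1) by (rule gdelta_in_subset)
  from Z0(1) obtain W where
    "(\<forall>n. openin Z (W n)) \<and> (\<forall>n. W (Suc n) \<subseteq> W n) \<and> \<Inter>(range W) = Z\<^sub>0"
    unfolding gdelta_in_descending by (elim exE)
  then have W: "\<And>n. openin Z (W n)" "\<Inter>(range W) = Z\<^sub>0" by simp_all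
  have dense: "Z\<^sub>0 \<inter> V \<noteq> {}" if "openin Z V" "V \<noteq> {}" for V
    using Z0(2) that unfolding dense_intersects_open by metis
  \<comment> \<open>a third each for the two approximation errors and for the oscillation of the approximating function\<close>
  define \<delta> where "\<delta> = \<epsilon> / 3"
  have \<delta>: "0 < \<delta>" using \<epsilon> by (simp add: \<delta>_def)
  have pair: "\<exists>u\<in>D. \<exists>v\<in>D. \<exists>x\<in>V. (\<forall>a\<in>S. \<bar>e u a - e v a\<bar> < \<eta>) \<and> \<delta> < \<bar>e u x - e v x\<bar>"
    if V: "openin Z V" "V \<noteq> {}" and S: "finite S" "S \<subseteq> topspace Z" and \<eta>: "0 < \<eta>" for V S \<eta>
  proof (rule ccontr)
    assume "\<not> ?thesis"
    then have near: "\<bar>e u x - e v x\<bar> \<le> \<delta>"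
      if "u \<in> D" "v \<in> D" "\<forall>a\<in>S. \<bar>e u a - e v a\<bar> < \<eta>" "x \<in> V" for u v x
      using that not_le by metis
    have "bounded ((\<lambda>g. e g a) ` D)" if "a \<in> S" for a
    proof -
      have "a \<in> topspace Z" using that S by blast
      then have "compactin euclideanreal ((\<lambda>g. e g a) ` topspace K)"
        using K ev unfolding compact_space_def by (intro image_compactin) auto
      then have "bounded ((\<lambda>g. e g a) ` topspace K)" by (simp add: compact_imp_bounded)
      then show ?thesis using D by (rule bounded_subset[OF _ image_mono])
    qed
    then obtain N where N: "finite N" "N \<subseteq> D"
      "\<And>g. g \<in> D \<Longrightarrow> \<exists>h\<in>N. \<forall>a\<in>S. \<bar>e g a - e h a\<bar> < \<eta>"
      using pointwise_bounded_imp_finite_net[OF S(1) \<eta>, of e D] by metis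
    obtain z where z: "z \<in> V" using V(2) by blast
    have zZ: "z \<in> topspace Z" using z openin_subset[OF V(1)] by blast
    define B where "B h = {x \<in> topspace Z. e h x \<in> ball (e h z) (\<delta> / 2)}" for h
    have oB: "openin Z (B h)" if "h \<in> N" for h
      unfolding B_def using cont[of h] N(2) that by (intro openin_continuous_map_preimage) auto
    define U where "U = V \<inter> (topspace Z \<inter> \<Inter>(B ` N))"
    have "openin Z (topspace Z \<inter> \<Inter>(B ` N))"
    proof (cases "N = {}")
      case False
      then show ?thesis using N(1) oB by (intro openin_Int openin_Inter) auto
    qed simp
    with V(1) have oU: "openin Z U" unfolding U_def by (rule openin_Int)
    have zU: "z \<in> U" unfolding U_def B_def using z zZ \<delta> by simp
    have "osc_le (e ` D) \<epsilon> U"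
      unfolding osc_le_def
    proof clarify
      fix g x y assume g: "g \<in> D" and x: "x \<in> U" and y: "y \<in> U"
      obtain h where h: "h \<in> N" "\<forall>a\<in>S. \<bar>e g a - e h a\<bar> < \<eta>" using N(3)[OF g] by blast
      have hD: "h \<in> D" using h N(2) by blast
      have "x \<in> V" "y \<in> V" "x \<in> B h" "y \<in> B h" using x y h(1) unfolding U_def by blast+
      then have "\<bar>e g x - e h x\<bar> \<le> \<delta>" "\<bar>e g y - e h y\<bar> \<le> \<delta>"
        "\<bar>e h z - e h x\<bar> < \<delta> / 2" "\<bar>e h z - e h y\<bar> < \<delta> / 2"
        using near[OF g hD h(2)] by (auto simp: B_def dist_real_def)
      then show "\<bar>e g x - e g y\<bar> \<le> \<epsilon>" unfolding \<delta>_def by linarith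
    qed
    then show False using none[OF oU] zU by blast
  qed

  define separates where "separates n V S V' a u v \<longleftrightarrow>
      openin Z V' \<and> a \<in> V' \<and> a \<in> Z\<^sub>0 \<and> Z closure_of V' \<subseteq> V \<inter> W n \<and> u \<in> D \<and> v \<in> D \<and>
      (\<forall>x\<in>V'. \<delta> < \<bar>e u x - e v x\<bar>) \<and> (\<forall>b\<in>S. \<bar>e u b - e v b\<bar> < 1 / Suc n)"
    for n :: nat and V S V' a u v
  have step: "\<exists>V' a u v. separates n V S V' a u v"
    if V: "openin Z V" "V \<noteq> {}" and S: "finite S" "S \<subseteq> topspace Z" for n :: nat and V S
  proof -
    have VW: "openin Z (V \<inter> W n)" using V(1) W(1) by (rule openin_Int)
    have "Z\<^sub>0 \<subseteq> W n" using W(2) by blast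
    then have "V \<inter> W n \<noteq> {}" using dense[OF V] by blast
    then obtain u v x where uv: "u \<in> D" "v \<in> D" and x: "x \<in> V \<inter> W n"
      and close: "\<forall>b\<in>S. \<bar>e u b - e v b\<bar> < 1 / Suc n" and far: "\<delta> < \<bar>e u x - e v x\<bar>"
      using pair[OF VW _ S, of "1 / Suc n"] by auto
    define Q where "Q = {y \<in> topspace Z. \<bar>e u y - e v y\<bar> \<in> {\<delta><..}}"
    have "openin Z Q"
      unfolding Q_def using cont uv
      by (intro openin_continuous_map_preimage[where Y = euclideanreal])
        (auto intro!: continuous_map_real_abs continuous_map_diff)
    with VW have "openin Z (V \<inter> W n \<inter> Q)" by (rule openin_Int)
    moreover have "x \<in> V \<inter> W n \<inter> Q" using x far openin_subset[OF V(1)] unfolding Q_def by auto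
    ultimately obtain V' where V': "openin Z V'" "x \<in> V'" "Z closure_of V' \<subseteq> V \<inter> W n \<inter> Q"
      by (rule regular_space_shrink[OF reg])
    obtain a where a: "a \<in> Z\<^sub>0" "a \<in> V'" using dense[OF V'(1)] V'(2) by blast
    have "V' \<subseteq> Q" using V'(3) closure_of_subset[OF openin_subset[OF V'(1)]] by blast
    then have "\<forall>x\<in>V'. \<delta> < \<bar>e u x - e v x\<bar>" unfolding Q_def by auto
    moreover have "Z closure_of V' \<subseteq> V \<inter> W n" using V'(3) by blast
    ultimately show ?thesis using V'(1) a uv close unfolding separates_def by blast
  qed
  \<comment> \<open>\<open>nV\<close>, \<open>na\<close>, \<open>nu\<close>, \<open>nv\<close> below choose the next open set, point and pair of indices\<close>
  define t where "t n V S = (SOME t. separates n V S (fst t) (fst (snd t)) (fst (snd (snd t)))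
      (snd (snd (snd t))))" for n V S
  define nV na nu nv where "nV n V S = fst (t n V S)" and "na n V S = fst (snd (t n V S))"
    and "nu n V S = fst (snd (snd (t n V S)))" and "nv n V S = snd (snd (snd (t n V S)))" for n V S
  have next_step: "separates n V S (nV n V S) (na n V S) (nu n V S) (nv n V S)"
    if "openin Z V" "V \<noteq> {}" "finite S" "S \<subseteq> topspace Z" for n V S
  proof -
    have "\<exists>t. separates n V S (fst t) (fst (snd t)) (fst (snd (snd t))) (snd (snd (snd t)))"
      using step[OF that, of n] by auto
    then show ?thesis unfolding nV_def na_def nu_def nv_def t_def by (rule someI_ex)
  qed
  define P where "P = rec_nat (topspace Z, {}) (\<lambda>n (V, S). (nV n V S, insert (na n V S) S))"
  define V where "V n = fst (P n)" for n
  define S where "S n = snd (P n)" for n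
  define a where "a n = na n (V n) (S n)" for n
  define u where "u n = nu n (V n) (S n)" for n
  define v where "v n = nv n (V n) (S n)" for n
  have P0: "V 0 = topspace Z" "S 0 = {}" by (simp_all add: V_def S_def P_def)
  have PS: "V (Suc n) = nV n (V n) (S n)" "S (Suc n) = insert (a n) (S n)" for n
    by (simp_all add: V_def S_def P_def a_def split: prod.split)
  have inv: "openin Z (V n) \<and> V n \<noteq> {} \<and> finite (S n) \<and> S n \<subseteq> Z\<^sub>0" for n
  proof (induction n)
    case 0
    then show ?case using Z(3) by (simp add: P0)
  next
    case (Suc n)
    then have "S n \<subseteq> topspace Z" using Z0Z by blast
    then show ?case using next_step[of "V n" "S n" n] Suc
      by (auto simp: PS a_def separates_def)
  qed
  have SZ: "S n \<subseteq> topspace Z" for n using inv[of n] Z0Z by blast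
  have st: "a n \<in> V (Suc n)" "a n \<in> Z\<^sub>0" "Z closure_of V (Suc n) \<subseteq> V n \<inter> W n" "u n \<in> D" "v n \<in> D"
    "\<And>x. x \<in> V (Suc n) \<Longrightarrow> \<delta> < \<bar>e (u n) x - e (v n) x\<bar>"
    "\<And>b. b \<in> S n \<Longrightarrow> \<bar>e (u n) b - e (v n) b\<bar> < 1 / Suc n" for n
    using next_step[of "V n" "S n" n] inv[of n] SZ[of n]
    by (simp_all add: PS a_def u_def v_def separates_def)
  have Vdec: "V (Suc n) \<subseteq> V n" for n
    using st(3)[of n] closure_of_subset[OF openin_subset, of Z "V (Suc n)"] inv by blast
  have Smono: "S m \<subseteq> S n" if "m \<le> n" for m n
    using that by (rule lift_Suc_mono_le[rotated]) (auto simp: PS)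

  have "(\<Inter>n. Z closure_of (range a \<inter> V n)) \<noteq> {}"
  proof (rule compact_space_imp_nest[OF Z(1)])
    fix n
    show "closedin Z (Z closure_of (range a \<inter> V n))" by simp
    have "range a \<inter> V n \<subseteq> topspace Z" using inv[of n] openin_subset by blast
    moreover have "a n \<in> range a \<inter> V n" using st(1) Vdec by blast
    ultimately show "Z closure_of (range a \<inter> V n) \<noteq> {}" by (metis closure_of_subset empty_iff subsetD)
  next
    show "decseq (\<lambda>n. Z closure_of (range a \<inter> V n))"
      using Vdec by (intro decseq_SucI closure_of_mono) blast
  qed
  then obtain z where z: "\<And>n. z \<in> Z closure_of (range a \<inter> V n)" by blast
  have zV: "z \<in> V n \<inter> W n" for n
    using z[of "Suc n"] st(3)[of n] closure_of_mono[of "range a \<inter> V (Suc n)" "V (Suc n)" Z] by blast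
  then have zZ0: "z \<in> Z\<^sub>0" using W(2) by blast
  then have zZ: "z \<in> topspace Z" using Z0Z by blast
  have za: "z \<in> Z closure_of (range a)"
    using z[of 0] closure_of_mono[of "range a \<inter> V 0" "range a" Z] by blast

  \<comment> \<open>pairs that differ by at least \<open>\<delta>\<close> at \<open>z\<close> and by at most \<open>1/(n+1)\<close> at the first points: nested, and
      closed in \<open>K \<times> K\<close> because evaluation is continuous in the first variable\<close>
  define far where "far = {r \<in> topspace (prod_topology K K). \<delta> \<le> \<bar>e (fst r) z - e (snd r) z\<bar>}"
  define apart where "apart b n = {r \<in> topspace (prod_topology K K).
      1 / Suc n < \<bar>e (fst r) b - e (snd r) b\<bar>}" for b and n :: nat
  define Q where "Q n = far - (\<Union>b\<in>S n. apart b n)" for n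
  have contKK: "continuous_map (prod_topology K K) euclideanreal (\<lambda>r. \<bar>e (fst r) x - e (snd r) x\<bar>)"
    if "x \<in> topspace Z" for x
    using continuous_map_compose[OF continuous_map_fst ev[OF that]]
      continuous_map_compose[OF continuous_map_snd ev[OF that]]
    by (intro continuous_map_real_abs continuous_map_diff) (auto simp: o_def)
  have "(\<Inter>n. Q n) \<noteq> {}"
  proof (rule compact_space_imp_nest[of "prod_topology K K"])
    show "compact_space (prod_topology K K)" using K by (simp add: compact_space_prod_topology)
    fix n
    show "closedin (prod_topology K K) (Q n)"
    proof -
      have "closedin (prod_topology K K) far"
        using closedin_continuous_map_preimage[OF contKK[OF zZ], of "{\<delta>..}"] by (simp add: far_def)
      moreover have "openin (prod_topology K K) (apart b n)" if "b \<in> S n" for b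
        using openin_continuous_map_preimage[OF contKK, of b "{1 / Suc n<..}"] that SZ[of n]
        by (auto simp: apart_def)
      ultimately show ?thesis unfolding Q_def by (intro closedin_diff openin_Union) auto
    qed
    have "(u n, v n) \<in> Q n"
    proof -
      have "u n \<in> topspace K" "v n \<in> topspace K" using st(4,5) D by auto
      moreover have "\<delta> \<le> \<bar>e (u n) z - e (v n) z\<bar>" using st(6)[of z n] zV[of "Suc n"] by simp
      ultimately show ?thesis unfolding Q_def far_def apart_def using st(7)[of _ n] by fastforce
    qed
    then show "Q n \<noteq> {}" by blast
  next
    show "decseq Q"
    proof (rule decseq_SucI)
      fix n
      have "1 / real (Suc (Suc n)) \<le> 1 / real (Suc n)" by (simp add: field_simps)
      then have "apart b n \<subseteq> apart b (Suc n)" for b unfolding apart_def by force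
      then show "Q (Suc n) \<subseteq> Q n"
        using PS(2)[of n] unfolding Q_def by blast
    qed
  qed
  then obtain p q where pq: "\<And>n. (p, q) \<in> Q n" by auto
  have pqK: "p \<in> topspace K" "q \<in> topspace K" using pq[of 0] unfolding Q_def far_def apart_def by auto
  have "e p (a m) = e q (a m)" for m
  proof -
    have "\<bar>e p (a m) - e q (a m)\<bar> \<le> 1 / Suc n" if "Suc m \<le> n" for n
    proof -
      have "a m \<in> S n" using Smono[OF that] PS by blast
      then show ?thesis using pq[of n] unfolding Q_def far_def apart_def by force
    qed
    then have "\<bar>e p (a m) - e q (a m)\<bar> \<le> 0"
      by (intro LIMSEQ_le_const[OF lim_1_over_n[THEN LIMSEQ_Suc]] exI[of _ "Suc m"]) auto
    then show ?thesis by simp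
  qed
  then have eq: "e p x = e q x" if "x \<in> range a" for x using that by blast
  have "range a \<subseteq> Z\<^sub>0" using st(2) by blast
  then have "z \<in> subtopology Z Z\<^sub>0 closure_of range a"
    using za zZ0 by (simp add: closure_of_subtopology Int_absorb1)
  then have "e p z = e q z"
    using forall_in_closure_of_eq[OF _ _ cont0[OF pqK(1)] cont0[OF pqK(2)]] eq by auto
  moreover have "\<delta> \<le> \<bar>e p z - e q z\<bar>" using pq[of 0] unfolding Q_def far_def apart_def by auto
  ultimately show False using \<delta> by simp
qed

section \<open>Translates and the enveloping semigroup\<close>

text \<open>The generated subgroup is exhausted by countable stages, each adding inverses and products.\<close>
lemma countable_subset_extends_to_countable_subgroup:
  assumes "group G" "countable S" "S \<subseteq> carrier G"
  obtains H where "subgroup H G" "countable H" "S \<subseteq> H"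
proof -
  interpret group G by fact
  define A where "A = rec_nat (insert \<one>\<^bsub>G\<^esub> S)
    (\<lambda>_ B. B \<union> (\<lambda>g. inv\<^bsub>G\<^esub> g) ` B \<union> (\<lambda>(g, h). g \<otimes>\<^bsub>G\<^esub> h) ` (B \<times> B))"
  have A0: "A 0 = insert \<one>\<^bsub>G\<^esub> S" and AS: "A (Suc n) =
      A n \<union> (\<lambda>g. inv\<^bsub>G\<^esub> g) ` A n \<union> (\<lambda>(g, h). g \<otimes>\<^bsub>G\<^esub> h) ` (A n \<times> A n)" for n
    by (simp_all add: A_def)
  have mono: "A m \<subseteq> A n" if "m \<le> n" for m n
    by (rule lift_Suc_mono_le[OF _ that]) (simp add: AS le_supI1)
  have carr: "A n \<subseteq> carrier G" for n
    using assms(3) by (induction n) (auto simp: A0 AS)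
  have "countable (A n)" for n
    using assms(2) by (induction n) (auto simp: A0 AS)
  then have "countable (\<Union>n. A n)" by blast
  moreover have "S \<subseteq> (\<Union>n. A n)" using A0 by blast
  moreover have "subgroup (\<Union>n. A n) G"
  proof
    show "(\<Union>n. A n) \<subseteq> carrier G" using carr by blast
    show "\<one>\<^bsub>G\<^esub> \<in> (\<Union>n. A n)" using A0 by blast
    fix x assume "x \<in> (\<Union>n. A n)"
    then obtain m where m: "x \<in> A m" by blast
    then have "inv\<^bsub>G\<^esub> x \<in> A (Suc m)" by (simp add: AS)
    then show "inv\<^bsub>G\<^esub> x \<in> (\<Union>n. A n)" by blast
    fix y assume "y \<in> (\<Union>n. A n)"
    then obtain n where n: "y \<in> A n" by blast
    have "x \<in> A (max m n)" "y \<in> A (max m n)" using m n mono[of m "max m n"] mono[of n "max m n"] by auto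
    then have "x \<otimes>\<^bsub>G\<^esub> y \<in> A (Suc (max m n))" by (force simp: AS)
    then show "x \<otimes>\<^bsub>G\<^esub> y \<in> (\<Union>n. A n)" by blast
  qed
  ultimately show thesis using that by blast
qed

abbreviation translates where "translates X \<phi> f H \<equiv> induced_map X f ` \<phi> ` H"

context compact_G_system
begin

lemma translation_continuous:
  assumes "g \<in> carrier G"
  shows "continuous_map X X (\<phi> g)"
proof -
  have "continuous_map X (prod_topology T X) (\<lambda>x. (g, x))"
    using assms topspace_eq by (intro continuous_map_pairedI) auto
  then have "continuous_map X X ((\<lambda>(g, x). \<phi> g x) \<circ> (\<lambda>x. (g, x)))"
    using continuous_action by (rule continuous_map_compose)
  then show ?thesis by (simp add: o_def)
qed

lemma translation_closed: "g \<in> carrier G \<Longrightarrow> x \<in> topspace X \<Longrightarrow> \<phi> g x \<in> topspace X"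
  using element_image by blast

lemma translation_in_product:
  "g \<in> carrier G \<Longrightarrow> \<phi> g \<in> topspace (product_topology (\<lambda>_. X) (topspace X))"
  using bij_prop0 translation_closed by (auto simp: Bij_def PiE_def)

lemma translations_subset_enveloping_semigroup: "\<phi> ` carrier G \<subseteq> enveloping_semigroup G X \<phi>"
  unfolding enveloping_semigroup_def
  by (intro closure_of_subset image_subsetI translation_in_product)

lemma induced_map_translation_continuous:
  assumes "continuous_map X euclideanreal f" "g \<in> carrier G"
  shows "continuous_map X euclideanreal (induced_map X f (\<phi> g))"
  using continuous_map_compose[OF translation_continuous[OF assms(2)] assms(1)]
  by (rule continuous_map_eq) (simp add: induced_map_def)

lemma evaluation_continuous:
  assumes "continuous_map X euclideanreal f" "x \<in> topspace X"
  shows "continuous_map (product_topology (\<lambda>_. X) (topspace X)) euclideanreal (\<lambda>p. f (p x))"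
  using continuous_map_compose[OF continuous_map_product_projection[OF assms(2)] assms(1)]
  by (simp add: o_def)

text \<open>For fixed \<open>x\<close> and \<open>y\<close> the inequality defines a closed set of maps in the product topology.\<close>
lemma osc_le_enveloping_family:
  assumes f: "continuous_map X euclideanreal f" and B: "B \<subseteq> topspace X"
    and osc: "osc_le (translates X \<phi> f (carrier G)) \<epsilon> B"
  shows "osc_le (enveloping_family G X \<phi> f) \<epsilon> B"
  unfolding osc_le_def enveloping_family_def
proof clarify
  fix p x y
  assume p: "p \<in> enveloping_semigroup G X \<phi>" and x: "x \<in> B" and y: "y \<in> B"
  have xy: "x \<in> topspace X" "y \<in> topspace X" using x y B by auto
  let ?P = "product_topology (\<lambda>_. X) (topspace X)"
  have "continuous_map ?P euclideanreal (\<lambda>p. \<bar>f (p x) - f (p y)\<bar>)"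
    using evaluation_continuous[OF f] xy by (intro continuous_map_real_abs continuous_map_diff)
  then have "closedin ?P {p \<in> topspace ?P. \<bar>f (p x) - f (p y)\<bar> \<in> {..\<epsilon>}}"
    by (rule closedin_continuous_map_preimage) simp
  moreover have "\<phi> ` carrier G \<subseteq> {p \<in> topspace ?P. \<bar>f (p x) - f (p y)\<bar> \<in> {..\<epsilon>}}"
  proof clarify
    fix g assume g: "g \<in> carrier G"
    have "\<phi> g \<in> topspace ?P" using g by (rule translation_in_product)
    moreover have "\<bar>f (\<phi> g x) - f (\<phi> g y)\<bar> \<le> \<epsilon>"
      using osc_leD[OF osc _ x y, of "induced_map X f (\<phi> g)"] g xy by (simp add: induced_map_def)
    ultimately show "\<phi> g \<in> topspace ?P \<and> \<bar>f (\<phi> g x) - f (\<phi> g y)\<bar> \<in> {..\<epsilon>}" by simp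
  qed
  ultimately have "enveloping_semigroup G X \<phi> \<subseteq> {p \<in> topspace ?P. \<bar>f (p x) - f (p y)\<bar> \<in> {..\<epsilon>}}"
    unfolding enveloping_semigroup_def by (intro closure_of_minimal)
  then show "\<bar>induced_map X f p x - induced_map X f p y\<bar> \<le> \<epsilon>"
    using p xy by (auto simp: induced_map_def)
qed

lemma translates_subset_enveloping_family:
  "H \<subseteq> carrier G \<Longrightarrow> translates X \<phi> f H \<subseteq> enveloping_family G X \<phi> f"
  unfolding enveloping_family_def using translations_subset_enveloping_semigroup by blast

lemma fragmented_translates_iff:
  assumes f: "continuous_map X euclideanreal f"
  shows "fragmented_family X (enveloping_family G X \<phi> f) \<longleftrightarrow>
    fragmented_family X (translates X \<phi> f (carrier G))"
proof
  assume "fragmented_family X (enveloping_family G X \<phi> f)"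
  then show "fragmented_family X (translates X \<phi> f (carrier G))"
    by (rule fragmented_family_mono) (rule translates_subset_enveloping_family, rule order_refl)
next
  assume frag: "fragmented_family X (translates X \<phi> f (carrier G))"
  show "fragmented_family X (enveloping_family G X \<phi> f)"
    unfolding fragmented_family_iff_osc_le
  proof (intro allI impI, elim conjE)
    fix A and \<epsilon> :: real assume A: "A \<subseteq> topspace X" "A \<noteq> {}" "0 < \<epsilon>"
    obtain U where U: "openin X U" "U \<inter> A \<noteq> {}"
      "osc_le (translates X \<phi> f (carrier G)) \<epsilon> (U \<inter> A)"
      using fragmented_familyD[OF frag A] .
    have "U \<inter> A \<subseteq> topspace X" using A(1) by blast
    then have "osc_le (enveloping_family G X \<phi> f) \<epsilon> (U \<inter> A)"
      using U(3) by (rule osc_le_enveloping_family[OF f])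
    then show "\<exists>U. openin X U \<and> U \<inter> A \<noteq> {} \<and> osc_le (enveloping_family G X \<phi> f) \<epsilon> (U \<inter> A)"
      using U(1,2) by (intro exI[of _ U] conjI)
  qed
qed

lemma orbit_difference_le_orbit_pseudometric:
  assumes f: "continuous_map X euclideanreal f" and H: "H \<subseteq> carrier G" "h \<in> H"
    and xy: "x \<in> topspace X" "y \<in> topspace X"
  shows "\<bar>f (\<phi> h x) - f (\<phi> h y)\<bar> \<le> orbit_pseudometric \<phi> H f x y"
proof -
  have "compactin euclideanreal (f ` topspace X)"
    using compact[unfolded compact_space_def] f by (rule image_compactin)
  then have "bounded (f ` topspace X)" by (simp add: compact_imp_bounded)
  then obtain M where "\<forall>r\<in>f ` topspace X. norm r \<le> M" unfolding bounded_iff by (elim exE)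
  then have M: "\<bar>f z\<bar> \<le> M" if "z \<in> topspace X" for z using that by simp
  have "\<bar>f (\<phi> k x) - f (\<phi> k y)\<bar> \<le> 2 * M" if "k \<in> H" for k
  proof -
    have "k \<in> carrier G" using that H by blast
    then have "\<bar>f (\<phi> k x)\<bar> \<le> M" "\<bar>f (\<phi> k y)\<bar> \<le> M" using M translation_closed xy by blast+
    then show ?thesis by linarith
  qed
  then have "bdd_above ((\<lambda>h. \<bar>f (\<phi> h x) - f (\<phi> h y)\<bar>) ` H)" by (intro bdd_aboveI2)
  then show ?thesis unfolding orbit_pseudometric_def using H(2) by (rule cSUP_upper[rotated])
qed

text \<open>In a separable pseudometric space, sending each point of an \<open>\<epsilon>\<close>-separated Cantor set to an
  \<open>\<epsilon>/2\<close>-near point of a countable dense set would be injective,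
  from an uncountable set to a countable one.\<close>
lemma Asp_imp_fragmented:
  assumes "f \<in> Asp G X \<phi>"
  shows "fragmented_family X (enveloping_family G X \<phi> f)"
proof -
  have f: "continuous_map X euclideanreal f" using assms by (simp add: Asp_def)
  have "fragmented_family X (translates X \<phi> f (carrier G))"
  proof (rule ccontr)
    assume nf: "\<not> ?thesis"
    have cont: "continuous_map X euclideanreal \<psi>" if "\<psi> \<in> translates X \<phi> f (carrier G)" for \<psi>
      using that induced_map_translation_continuous[OF f] by blast
    obtain C \<epsilon> and x :: "(nat \<Rightarrow> bool) \<Rightarrow> 'x" where C: "countable C" "C \<subseteq> translates X \<phi> f (carrier G)"
      and \<epsilon>: "0 < \<epsilon>" and xX: "\<And>\<sigma>. x \<sigma> \<in> topspace X"
      and sep: "\<And>\<sigma> \<tau>. \<sigma> \<noteq> \<tau> \<Longrightarrow> \<exists>\<psi>\<in>C. \<epsilon> < \<bar>\<psi> (x \<sigma>) - \<psi> (x \<tau>)\<bar>"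
      using not_fragmented_imp_separated_Cantor_set[OF compact Hausdorff cont nf] by blast
    obtain S where S: "countable S" "S \<subseteq> carrier G" "C = (\<lambda>g. induced_map X f (\<phi> g)) ` S"
      using C countable_subset_image[of C "\<lambda>g. induced_map X f (\<phi> g)" "carrier G"]
      by (auto simp: image_image)
    obtain H where H: "subgroup H G" "countable H" "S \<subseteq> H"
      using countable_subset_extends_to_countable_subgroup[OF is_group S(1,2)] .
    have HG: "H \<subseteq> carrier G" using H(1) by (rule subgroup.subset)
    obtain D where D: "countable D" "D \<subseteq> topspace X"
      and Dd: "\<forall>x\<in>topspace X. \<forall>\<epsilon>>0. \<exists>y\<in>D. orbit_pseudometric \<phi> H f x y < \<epsilon>"
      using assms H unfolding Asp_def pseudometric_separable_def by blast
    have "\<exists>y. y \<in> D \<and> orbit_pseudometric \<phi> H f (x \<sigma>) y < \<epsilon> / 2" for \<sigma>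
      using Dd xX[of \<sigma>] \<epsilon> by (meson half_gt_zero)
    then obtain y where y: "\<And>\<sigma>. y \<sigma> \<in> D" "\<And>\<sigma>. orbit_pseudometric \<phi> H f (x \<sigma>) (y \<sigma>) < \<epsilon> / 2"
      by metis
    have "inj y"
    proof (rule injI, rule ccontr)
      fix \<sigma> \<tau> assume eq: "y \<sigma> = y \<tau>" and "\<sigma> \<noteq> \<tau>"
      then obtain \<psi> where "\<psi> \<in> C" "\<epsilon> < \<bar>\<psi> (x \<sigma>) - \<psi> (x \<tau>)\<bar>" using sep by blast
      then obtain g where g: "g \<in> S" "\<epsilon> < \<bar>f (\<phi> g (x \<sigma>)) - f (\<phi> g (x \<tau>))\<bar>"
        using S(3) xX by (auto simp: induced_map_def)
      have near: "\<bar>f (\<phi> g (x \<upsilon>)) - f (\<phi> g (y \<upsilon>))\<bar> < \<epsilon> / 2" for \<upsilon>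
        using orbit_difference_le_orbit_pseudometric[OF f HG _ xX, of g "y \<upsilon>"] y[of \<upsilon>] D(2) g(1) H(3)
        by (meson le_less_trans subsetD)
      show False using near[of \<sigma>] near[of \<tau>] g(2) unfolding eq by linarith
    qed
    moreover have "range y \<subseteq> D" using y(1) by (rule image_subsetI)
    then have "countable (range y)" using D(1) by (rule countable_subset)
    ultimately have "countable (UNIV :: (nat \<Rightarrow> bool) set)"
      using countable_image_inj_on by blast
    then show False using uncountable_binary_sequences by contradiction
  qed
  then show ?thesis by (simp add: fragmented_translates_iff[OF f])
qed

lemma fragmented_imp_Asp:
  assumes f: "continuous_map X euclideanreal f"
    and frag: "fragmented_family X (enveloping_family G X \<phi> f)"
  shows "f \<in> Asp G X \<phi>"
  unfolding Asp_def pseudometric_separable_def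
proof (intro CollectI conjI f allI impI, elim conjE)
  fix H assume H: "subgroup H G" "countable H"
  have HG: "H \<subseteq> carrier G" using H(1) by (rule subgroup.subset)
  have He: "H \<noteq> {}" using H(1) subgroup.one_closed by blast
  let ?F = "translates X \<phi> f H"
  have cont: "continuous_map X euclideanreal \<psi>" if "\<psi> \<in> ?F" for \<psi>
    using that HG induced_map_translation_continuous[OF f] by blast
  have cF: "countable ?F" using H(2) by blast
  have fF: "fragmented_family X ?F"
    using frag translates_subset_enveloping_family[OF HG] by (rule fragmented_family_mono)
  have "\<exists>D. countable D \<and> D \<subseteq> topspace X \<and> (\<forall>x\<in>topspace X. \<exists>y\<in>D. \<forall>\<psi>\<in>?F. \<bar>\<psi> x - \<psi> y\<bar> \<le> 1 / Suc n)"
    for n :: nat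
    using fragmented_countable_imp_separable[OF compact cont cF fF, of "1 / Suc n"]
    by (metis of_nat_0_less_iff zero_less_Suc zero_less_divide_1_iff)
  then obtain D where D: "\<And>n. countable (D n)" "\<And>n. D n \<subseteq> topspace X"
    "\<And>n x. x \<in> topspace X \<Longrightarrow> \<exists>y\<in>D n. \<forall>\<psi>\<in>?F. \<bar>\<psi> x - \<psi> y\<bar> \<le> 1 / Suc n"
    by metis
  show "\<exists>D. countable D \<and> D \<subseteq> topspace X \<and>
      (\<forall>x\<in>topspace X. \<forall>\<epsilon>>0. \<exists>y\<in>D. orbit_pseudometric \<phi> H f x y < \<epsilon>)"
  proof (intro exI[of _ "\<Union>n. D n"] conjI ballI allI impI)
    show "countable (\<Union>n. D n)" using D(1) by blast
    show "(\<Union>n. D n) \<subseteq> topspace X" using D(2) by blast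
    fix x and \<epsilon> :: real assume x: "x \<in> topspace X" and "0 < \<epsilon>"
    then obtain n :: nat where n: "1 / Suc n < \<epsilon>" using nat_approx_posE by blast
    obtain y where y: "y \<in> D n" "\<forall>\<psi>\<in>?F. \<bar>\<psi> x - \<psi> y\<bar> \<le> 1 / Suc n" using D(3)[OF x] by blast
    have yX: "y \<in> topspace X" using y(1) D(2) by blast
    have "\<bar>f (\<phi> h x) - f (\<phi> h y)\<bar> \<le> 1 / Suc n" if "h \<in> H" for h
      using bspec[OF y(2), of "induced_map X f (\<phi> h)"] that x yX by (simp add: induced_map_def)
    then have "orbit_pseudometric \<phi> H f x y \<le> 1 / Suc n"
      unfolding orbit_pseudometric_def by (intro cSUP_least He)
    then have "orbit_pseudometric \<phi> H f x y < \<epsilon>" using n by linarith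
    then show "\<exists>y\<in>\<Union>n. D n. orbit_pseudometric \<phi> H f x y < \<epsilon>" using y(1) by blast
  qed
qed

lemma fragmented_imp_generically_continuous:
  assumes "fragmented_family X (enveloping_family G X \<phi> f)" "closedin X Y"
  shows "generically_continuous_on G X \<phi> f Y"
proof -
  obtain Y\<^sub>0 where Y\<^sub>0: "gdelta_in (subtopology X Y) Y\<^sub>0" "subtopology X Y closure_of Y\<^sub>0 = Y"
    "\<And>a. a \<in> Y\<^sub>0 \<Longrightarrow>
      equicontinuous_at (subtopology X Y) ((\<lambda>\<psi>. restrict \<psi> Y) ` enveloping_family G X \<phi> f) a"
    using fragmented_imp_generically_equicontinuous[OF compact Hausdorff assms] by blast
  have "Y\<^sub>0 \<subseteq> Y" using gdelta_in_subset[OF Y\<^sub>0(1)] by simp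
  then have "continuous_map (subtopology X Y\<^sub>0) euclideanreal (induced_map X f p)"
    if "p \<in> enveloping_semigroup G X \<phi>" for p
    using that Y\<^sub>0(3)
    by (intro equicontinuous_at_imp_continuous_map[of _ Y _ "enveloping_family G X \<phi> f"])
      (auto simp: enveloping_family_def)
  then show ?thesis unfolding generically_continuous_on_def using Y\<^sub>0(1,2) by blast
qed

lemma G_invariant_closure_orbits:
  assumes A: "A \<subseteq> topspace X"
  shows "G_invariant G \<phi> (X closure_of (\<Union>g\<in>carrier G. \<phi> g ` A))"
  unfolding G_invariant_def
proof
  fix h assume h: "h \<in> carrier G"
  let ?O = "\<Union>g\<in>carrier G. \<phi> g ` A"
  have "\<phi> h ` ?O \<subseteq> ?O"
  proof clarify
    fix g a assume g: "g \<in> carrier G" and a: "a \<in> A"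
    have "\<phi> h (\<phi> g a) = \<phi> (h \<otimes> g) a" using composition_rule[of a h g] h g a A by auto
    then show "\<phi> h (\<phi> g a) \<in> ?O" using h g a by blast
  qed
  then have "X closure_of \<phi> h ` ?O \<subseteq> X closure_of ?O" by (rule closure_of_mono)
  then show "\<phi> h ` (X closure_of ?O) \<subseteq> X closure_of ?O"
    using continuous_map_image_closure_subset[OF translation_continuous[OF h], of ?O] by order
qed

text \<open>A small open set \<open>V\<close> in the closure of the orbit of \<open>A\<close> contains some \<open>g a\<close> with \<open>a \<in> A\<close>. The points
  of \<open>A\<close> that \<open>g\<close> sends into \<open>V\<close> have equally small oscillation, because
  \<open>k \<mapsto> k g\<^sup>-\<^sup>1\<close> permutes the group.\<close>
lemma generically_continuous_imp_fragmented:
  assumes f: "continuous_map X euclideanreal f"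
    and gen: "\<And>Y. closedin X Y \<Longrightarrow> G_invariant G \<phi> Y \<Longrightarrow> generically_continuous_on G X \<phi> f Y"
  shows "fragmented_family X (enveloping_family G X \<phi> f)"
  unfolding fragmented_translates_iff[OF f]
  unfolding fragmented_family_iff_osc_le
proof (intro allI impI, elim conjE)
  fix A and \<epsilon> :: real assume A: "A \<subseteq> topspace X" "A \<noteq> {}" and \<epsilon>: "0 < \<epsilon>"
  define orb where "orb = (\<Union>g\<in>carrier G. \<phi> g ` A)"
  have orbX: "orb \<subseteq> topspace X" unfolding orb_def using translation_closed A(1) by blast
  define Y where "Y = X closure_of orb"
  have orbY: "orb \<subseteq> Y" unfolding Y_def using orbX by (rule closure_of_subset)
  have Y: "closedin X Y" "G_invariant G \<phi> Y"
    unfolding Y_def orb_def using G_invariant_closure_orbits[OF A(1)] by simp_all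
  have YX: "Y \<subseteq> topspace X" using Y(1) by (rule closedin_subset)
  have "Y \<noteq> {}" using A(2) orbY unfolding orb_def by blast
  let ?Z = "subtopology X Y"
  have tZ: "topspace ?Z = Y" using YX by (rule topspace_subtopology_subset)
  from gen[OF Y] obtain Y\<^sub>0 where Y\<^sub>0: "gdelta_in ?Z Y\<^sub>0" "?Z closure_of Y\<^sub>0 = Y"
    and Y\<^sub>0c: "\<And>p. p \<in> enveloping_semigroup G X \<phi> \<Longrightarrow>
      continuous_map (subtopology X Y\<^sub>0) euclideanreal (induced_map X f p)"
    unfolding generically_continuous_on_def by blast
  have Y\<^sub>0Y: "Y\<^sub>0 \<subseteq> Y" using gdelta_in_subset[OF Y\<^sub>0(1)] tZ by simp
  let ?P = "product_topology (\<lambda>_. X) (topspace X)"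
  let ?E = "enveloping_semigroup G X \<phi>"
  let ?K = "subtopology ?P ?E"
  have "closedin ?P ?E" unfolding enveloping_semigroup_def by simp
  moreover have "compact_space ?P" using compact by (simp add: compact_space_product_topology)
  ultimately have cK: "compact_space ?K"
    by (simp add: closedin_compact_space compact_space_subtopology)
  have tK: "topspace ?K = ?E"
    unfolding enveloping_semigroup_def by (rule topspace_subtopology_subset[OF closure_of_subset_topspace])
  have Z: "compact_space ?Z" "Hausdorff_space ?Z" "topspace ?Z \<noteq> {}"
    using compact Hausdorff Y(1) \<open>Y \<noteq> {}\<close> tZ
    by (simp_all add: closedin_compact_space compact_space_subtopology Hausdorff_space_subtopology)
  have ev: "continuous_map ?K euclideanreal (\<lambda>p. f (p x))" if "x \<in> topspace ?Z" for x
  proof -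
    have "x \<in> topspace X" using that tZ YX by blast
    then show ?thesis using evaluation_continuous[OF f] by (intro continuous_map_from_subtopology)
  qed
  have cont: "continuous_map ?Z euclideanreal (\<lambda>x. f (p x))" if p: "p \<in> \<phi> ` carrier G" for p
  proof -
    obtain g where g: "g \<in> carrier G" "p = \<phi> g" using p by blast
    have "continuous_map X euclideanreal (f \<circ> \<phi> g)"
      using translation_continuous[OF g(1)] f by (rule continuous_map_compose)
    then show ?thesis unfolding g(2) o_def by (rule continuous_map_from_subtopology)
  qed
  have cont0: "continuous_map (subtopology ?Z Y\<^sub>0) euclideanreal (\<lambda>x. f (p x))" if p: "p \<in> topspace ?K" for p
  proof -
    have eq: "subtopology ?Z Y\<^sub>0 = subtopology X Y\<^sub>0"
      using Y\<^sub>0Y by (simp add: subtopology_subtopology Int_absorb1)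
    have "continuous_map (subtopology X Y\<^sub>0) euclideanreal (induced_map X f p)"
      using p unfolding tK by (rule Y\<^sub>0c)
    then show ?thesis unfolding eq by (rule continuous_map_eq) (simp add: induced_map_def)
  qed
  have dense: "?Z closure_of Y\<^sub>0 = topspace ?Z" using Y\<^sub>0(2) tZ by simp
  have D: "\<phi> ` carrier G \<subseteq> topspace ?K"
    unfolding tK by (rule translations_subset_enveloping_semigroup)
  obtain V where V: "openin ?Z V" "V \<noteq> {}" "osc_le ((\<lambda>p x. f (p x)) ` \<phi> ` carrier G) \<epsilon> V"
    by (rule separately_continuous_imp_small_open[where e = "\<lambda>p x. f (p x)",
          OF cK Z D ev cont Y\<^sub>0(1) dense cont0 \<epsilon>])
  obtain W where W: "openin X W" "V = W \<inter> Y" using V(1) by (auto simp: openin_subtopology)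
  then have "W \<inter> orb \<noteq> {}"
    using V(2) openin_Int_closure_of_eq_empty[OF W(1), of orb] unfolding Y_def by blast
  then obtain g a where g: "g \<in> carrier G" and a: "a \<in> A" "\<phi> g a \<in> W" unfolding orb_def by blast
  define U where "U = {x \<in> topspace X. \<phi> g x \<in> W}"
  have "openin X U"
    unfolding U_def using translation_continuous[OF g] W(1) by (rule openin_continuous_map_preimage)
  moreover have "U \<inter> A \<noteq> {}" using a A(1) unfolding U_def by blast
  moreover have "osc_le (translates X \<phi> f (carrier G)) \<epsilon> (U \<inter> A)"
    unfolding osc_le_def
  proof clarify
    fix k x y assume k: "k \<in> carrier G" and x: "x \<in> U" "x \<in> A" and y: "y \<in> U" "y \<in> A"
    have gV: "\<phi> g z \<in> V" if "z \<in> U" "z \<in> A" for z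
      using that g orbY unfolding U_def W(2) orb_def by blast
    have kg: "k \<otimes> inv g \<in> carrier G" using k g by simp
    have shift: "\<phi> (k \<otimes> inv g) (\<phi> g z) = \<phi> k z" if "z \<in> A" for z
    proof -
      have "z \<in> topspace X" using that A(1) by blast
      then have "\<phi> (k \<otimes> inv g) (\<phi> g z) = \<phi> (k \<otimes> inv g \<otimes> g) z"
        using composition_rule[OF _ kg g] by simp
      then show ?thesis using k g by (simp add: m_assoc)
    qed
    have "\<bar>f (\<phi> (k \<otimes> inv g) (\<phi> g x)) - f (\<phi> (k \<otimes> inv g) (\<phi> g y))\<bar> \<le> \<epsilon>"
      using osc_leD[OF V(3) imageI[OF imageI[OF kg]] gV[OF x] gV[OF y]] .
    then show "\<bar>induced_map X f (\<phi> k) x - induced_map X f (\<phi> k) y\<bar> \<le> \<epsilon>"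
      using shift x(2) y(2) A(1) by (auto simp: induced_map_def subset_iff)
  qed
  ultimately show "\<exists>U. openin X U \<and> U \<inter> A \<noteq> {} \<and> osc_le (translates X \<phi> f (carrier G)) \<epsilon> (U \<inter> A)"
    by blast
qed

end


theorem theorem14p2:
  fixes G :: "('g, 'm) monoid_scheme" and T :: "'g topology"
    and X :: "'x topology" and \<phi> :: "'g \<Rightarrow> 'x \<Rightarrow> 'x" and f :: "'x \<Rightarrow> real"
  assumes "compact_G_system G T X \<phi>"
    and "continuous_map X euclideanreal f"
  shows "(f \<in> Asp G X \<phi> \<longleftrightarrow> fragmented_family X (enveloping_family G X \<phi> f)) \<and>
    (f \<in> Asp G X \<phi> \<longleftrightarrow> barely_continuous_family X (enveloping_family G X \<phi> f)) \<and>
    (f \<in> Asp G X \<phi> \<longleftrightarrow>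
       (\<forall>Y. closedin X Y \<longrightarrow> generically_continuous_on G X \<phi> f Y)) \<and>
    (f \<in> Asp G X \<phi> \<longleftrightarrow>
       (\<forall>Y. closedin X Y \<and> G_invariant G \<phi> Y \<longrightarrow> generically_continuous_on G X \<phi> f Y))"
proof -
  interpret compact_G_system G T X \<phi> by fact
  let ?EF = "enveloping_family G X \<phi> f"
  have Asp: "f \<in> Asp G X \<phi> \<longleftrightarrow> fragmented_family X ?EF"
    using Asp_imp_fragmented fragmented_imp_Asp[OF assms(2)] by blast
  have barely: "barely_continuous_family X ?EF \<longleftrightarrow> fragmented_family X ?EF"
    using barely_continuous_imp_fragmented fragmented_imp_barely_continuous[OF compact Hausdorff] by blast
  have "generically_continuous_on G X \<phi> f Y" if "fragmented_family X ?EF" "closedin X Y" for Y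
    using that by (rule fragmented_imp_generically_continuous)
  moreover have "fragmented_family X ?EF"
    if "\<And>Y. closedin X Y \<and> G_invariant G \<phi> Y \<Longrightarrow> generically_continuous_on G X \<phi> f Y"
    using generically_continuous_imp_fragmented[OF assms(2)] that by blast
  ultimately show ?thesis unfolding Asp barely by blast
qed

end
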